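(* Let $\mathbb{T}$, $\mathbb{T}^{\ast}$, $t_0$, $\delta_\pm$, $T$, $s$, $A$, $Q$, $G$, $P_T$, $\Phi_A$ be as in the context, where $A$, $Q$, $G$ satisfy the periodicity assumptions and the nontriviality assumption listed there and $z^{\Delta}(t)=A(t)z(t)$ is non-critical. Suppose there exist positive constants $E_1,E_2,E_3,N$ such that $$|Q(t,x)-Q(t,y)|\le E_1\|x-y\|,\qquad |G(t,x,y)-G(t,z,w)|\le E_2\|x-z\|+E_3\|y-w\|$$ (read as explained in the context), and $$r\left(\delta_+^T(t_0)-t_0\right)\left(\|A\|E_1+E_2+E_3\right)\le N,$$ where $$r=\max_{t\in[t_0,\delta_+^T(t_0)]_{\mathbb{T}}}\left(\max_{u\in[t,\delta_+^T(t)]_{\mathbb{T}}}\left|\left[\Phi_A(\sigma(u),t_0)\left(\Phi_A^{-1}(\delta_+^T(t_0),t_0)-I\right)\Phi_A^{-1}(t,t_0)\right]^{-1}\right|\right).$$ Let $\alpha:=\|Q(t,0)\|$ and $\beta:=\|G(t,0,0)\|$, and let $J$ be a positive constant satisfying $$E_1J+\alpha+r\left(\delta_+^T(t_0)-t_0\right)\left[\|A\|(\alpha+E_1J)+(E_2+E_3)J+\beta\right]\le J.$$ Then the delay dynamic system $$x^{\Delta}(t)=A(t)x(t)+Q^{\Delta}\left(t,x(\delta_-(s,t))\right)+G\left(t,x(t),x(\delta_-(s,t))\right)$$ has a solution in $\mathbb{M}:=\{\varphi\in P_T:\|\varphi\|\le J\}$.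
   Context: Time scale calculus. A time scale $\mathbb{T}$ is a nonempty closed subset of $\mathbb{R}$; $\sigma$ is the forward jump operator, $f^{\Delta}$ the delta derivative, and rd-continuity ($C_{rd}$), regressivity and the delta integral are the usual ones; $[a,b]_{\mathbb{T}}=[a,b]\cap\mathbb{T}$ (similarly for other intervals). Shift operators. $\mathbb{T}^{\ast}$ is a nonempty subset of $\mathbb{T}$ containing a fixed number $t_0$, and $\delta_\pm:[t_0,\infty)_{\mathbb{T}}\times\mathbb{T}^{\ast}\to\mathbb{T}^{\ast}$ are operators, with $\mathcal{D}_\pm=\{(s,t)\in[t_0,\infty)_{\mathbb{T}}\times\mathbb{T}^{\ast}:\delta_\pm(s,t)\in\mathbb{T}^{\ast}\}$, such that: (1) $\delta_\pm$ are strictly increasing in their second argument: if $(T_0,t),(T_0,u)\in\mathcal{D}_\pm$, then $T_0\le t\le u$ implies $\delta_\pm(T_0,t)\le\delta_\pm(T_0,u)$; (2) if $(T_1,u),(T_2,u)\in\mathcal{D}_-$ with $T_1<T_2$ then $\delta_-(T_1,u)>\delta_-(T_2,u)$, and if $(T_1,u),(T_2,u)\in\mathcal{D}_+$ with $T_1<T_2$ then $\delta_+(T_1,u)<\delta_+(T_2,u)$; (3) if $t\in[t_0,\infty)_{\mathbb{T}}$ then $(t,t_0)\in\mathcal{D}_+$ and $\delta_+(t,t_0)=t$; if $t\in\mathbb{T}^{\ast}$ then $(t_0,t)\in\mathcal{D}_+$ and $\delta_+(t_0,t)=t$; (4) if $(s,t)\in\mathcal{D}_\pm$ then $(s,\delta_\pm(s,t))\in\mathcal{D}_\mp$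 and $\delta_\mp(s,\delta_\pm(s,t))=t$; (5) if $(s,t)\in\mathcal{D}_\pm$ and $(u,\delta_\pm(s,t))\in\mathcal{D}_\mp$ then $(s,\delta_\mp(u,t))\in\mathcal{D}_\pm$ and $\delta_\mp(u,\delta_\pm(s,t))=\delta_\pm(s,\delta_\mp(u,t))$. Periodicity. $\mathbb{T}$ is periodic in shifts $\delta_\pm$ if there is $p\in(t_0,\infty)_{\mathbb{T}^{\ast}}$ with $(p,t)\in\mathcal{D}_\mp$ for all $t\in\mathbb{T}^{\ast}$; the infimum $P$ of such $p$, if $P>t_0$, is its period, and $\mathbb{T}$ is then called $P$-periodic in shifts. A function $f$ on $\mathbb{T}^{\ast}$ is periodic in shifts $\delta_\pm$ if for some $T\in[P,\infty)_{\mathbb{T}^{\ast}}$ one has $(T,t)\in\mathcal{D}_\pm$ and $f(\delta_\pm^T(t))=f(t)$ for all $t\in\mathbb{T}^{\ast}$, where $\delta_\pm^T(t)=\delta_\pm(T,t)$. It is $\Delta$-periodic in shifts with $T$ if $(T,t)\in\mathcal{D}_\pm$ for all $t\in\mathbb{T}^{\ast}$, the shifts $\delta_\pm^T$ are $\Delta$-differentiable with rd-continuous derivatives $\delta_\pm^{\Delta T}$, and $f(\delta_\pm^T(t))\,\delta_\pm^{\Delta T}(t)=f(t)$ for all $t\in\mathbb{T}^{\ast}$. Here $T>0$ and $\mathbb{T}$ is assumed to be $T$-periodic in shifts. Spaces and norms. $P_T$ is the set of all $n$-vector functions $x(t)$ periodic in shifts with period $T$, i.e. $x(\delta_\pm^T(t))=x(t)$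 for all $t\in\mathbb{T}^{\ast}$, regarded as a Banach space with norm $\|x\|=\max_{t\in[t_0,\delta_+^T(t_0)]_{\mathbb{T}}}|x(t)|$, where $|\cdot|$ on $\mathbb{R}^n$ is the maximum norm; the same formula defines $\|\cdot\|$ for other $n$-vector functions of $t$, such as $Q(t,0)$ and $G(t,0,0)$. For a matrix function $A(t)=[a_{ij}(t)]$, $|A(t)|=\max_{1\le i\le n}\sum_{j=1}^n|a_{ij}(t)|$ and $\|A\|=\sup_{t\in[t_0,\infty)_{\mathbb{T}}}|A(t)|$. Data of the system. $s\in[t_0,\infty)_{\mathbb{T}}$ is fixed; $A\in C_{rd}(\mathbb{T}^{\ast},\mathbb{R}^{n\times n})$ is regressive, $Q\in C_{rd}(\mathbb{T}^{\ast}\times\mathbb{R}^n,\mathbb{R}^n)$, $G\in C_{rd}(\mathbb{T}^{\ast}\times\mathbb{R}^n\times\mathbb{R}^n,\mathbb{R}^n)$; $Q^{\Delta}(t,x(\delta_-(s,t)))$ is the $\Delta$-derivative of $t\mapsto Q(t,x(\delta_-(s,t)))$. Periodicity assumptions, for all $t\in\mathbb{T}^{\ast}$ and $x\in P_T$: $A$ is $\Delta$-periodic in shifts, i.e. $A(\delta_\pm^T(t))\delta_\pm^{\Delta T}(t)=A(t)$; $Q(\delta_\pm^T(t),x(\delta_-(s,\delta_\pm^T(t))))=Q(t,x(\delta_-(s,t)))$; $G(\delta_\pm^T(t),x(\delta_\pm^T(t)),x(\delta_-(s,\delta_\pm^T(t))))\,\delta_\pm^{\Delta T}(t)=G(t,x(t),x(\delta_-(s,t)))$.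 Nontriviality assumption: $Q^{\Delta}(t,0)+G(t,0,0)\neq0$ for some $t\in\mathbb{T}^{\ast}$. $\Phi_A(t,t_0)$ is the transition matrix of $z^{\Delta}=A(t)z$: $\Phi_A^{\Delta}(t,t_0)=A(t)\Phi_A(t,t_0)$, $\Phi_A(t_0,t_0)=I$. Non-critical means that $z^{\Delta}=A(t)z$ has no nonzero solution that is periodic in shifts $\delta_\pm$. Lipschitz conditions. In these, $\|\cdot\|$ is the norm of $P_T$; they are required for all $t\in\mathbb{T}^{\ast}$ and $x,y,z,w\in P_T$, where $Q(t,x)$ stands for $Q(t,x(\delta_-(s,t)))$ and $G(t,x,y)$ for $G(t,x(t),y(\delta_-(s,t)))$. *)

theory Defs
  imports "HOL-Analysis.Analysis"
begin

section \<open>Time scales\<close>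

locale time_scale =
  fixes \<T> :: "real set"
  assumes nonempty: "\<T> \<noteq> {}" and closed: "closed \<T>"

text \<open>The conventions inf {} = sup \<open>\<T>\<close> and sup {} = inf \<open>\<T>\<close>, which make the jump operators fix a
  maximum or a minimum of \<open>\<T>\<close>, are built in.\<close>

definition fwd_jump :: "real set \<Rightarrow> real \<Rightarrow> real" where
  "fwd_jump \<T> t = (if \<exists>u\<in>\<T>. t < u then Inf {u\<in>\<T>. t < u} else t)"

definition bwd_jump :: "real set \<Rightarrow> real \<Rightarrow> real" where
  "bwd_jump \<T> t = (if \<exists>u\<in>\<T>. u < t then Sup {u\<in>\<T>. u < t} else t)"

definition right_dense :: "real set \<Rightarrow> real \<Rightarrow> bool" where
  "right_dense \<T> t \<longleftrightarrow> (\<exists>u\<in>\<T>. t < u) \<and> fwd_jump \<T> t = t"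

definition left_dense :: "real set \<Rightarrow> real \<Rightarrow> bool" where
  "left_dense \<T> t \<longleftrightarrow> (\<exists>u\<in>\<T>. u < t) \<and> bwd_jump \<T> t = t"

text \<open>Functions on a subset \<open>S\<close> of \<open>\<T>\<close> are total HOL functions whose values outside \<open>S\<close> are
  irrelevant.  Density of points and the forward jump always refer to \<open>\<T>\<close>.\<close>

definition rd_continuous_on ::
    "real set \<Rightarrow> real set \<Rightarrow> (real \<Rightarrow> 'a::real_normed_vector) \<Rightarrow> bool" where
  "rd_continuous_on \<T> S f \<longleftrightarrow>
     (\<forall>t\<in>S. (right_dense \<T> t \<longrightarrow> continuous (at t within S) f) \<and>
            (left_dense \<T> t \<longrightarrow> (\<exists>l. (f \<longlongrightarrow> l) (at t within S \<inter> {..<t}))))"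

text \<open>A function with further arguments is rd-continuous if it becomes an rd-continuous function of
  time whenever continuous functions are substituted for these arguments (Bohner and Peterson).\<close>

definition rd_continuous_on2 ::
    "real set \<Rightarrow> real set \<Rightarrow>
     (real \<Rightarrow> 'b::real_normed_vector \<Rightarrow> 'a::real_normed_vector) \<Rightarrow> bool" where
  "rd_continuous_on2 \<T> S f \<longleftrightarrow>
     (\<forall>x. continuous_on S x \<longrightarrow> rd_continuous_on \<T> S (\<lambda>t. f t (x t)))"

definition rd_continuous_on3 ::
    "real set \<Rightarrow> real set \<Rightarrow>
     (real \<Rightarrow> 'b::real_normed_vector \<Rightarrow> 'c::real_normed_vector \<Rightarrow> 'a::real_normed_vector) \<Rightarrow> bool" where
  "rd_continuous_on3 \<T> S f \<longleftrightarrow>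
     (\<forall>x y. continuous_on S x \<and> continuous_on S y \<longrightarrow> rd_continuous_on \<T> S (\<lambda>t. f t (x t) (y t)))"

text \<open>The delta derivative on \<open>\<T>\<close> of a function defined on \<open>S\<close>: the function has to be defined at
  the forward jump of \<open>t\<close> and in a neighbourhood of \<open>t\<close> in \<open>\<T>\<close>.  The second conjunct removes a
  left-scattered maximum of \<open>\<T>\<close>, where the derivative would not be unique.\<close>

definition has_delta_deriv ::
    "real set \<Rightarrow> real set \<Rightarrow> (real \<Rightarrow> 'a::real_normed_vector) \<Rightarrow> 'a \<Rightarrow> real \<Rightarrow> bool" where
  "has_delta_deriv \<T> S f d t \<longleftrightarrow>
     t \<in> S \<and> ((\<exists>u\<in>\<T>. t < u) \<or> left_dense \<T> t) \<and> fwd_jump \<T> t \<in> S \<and>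
     (\<forall>\<epsilon>>0. \<exists>\<eta>>0. \<forall>u\<in>\<T>. \<bar>u - t\<bar> < \<eta> \<longrightarrow>
        u \<in> S \<and>
        norm (f (fwd_jump \<T> t) - f u - (fwd_jump \<T> t - u) *\<^sub>R d) \<le> \<epsilon> * \<bar>fwd_jump \<T> t - u\<bar>)"

definition delta_deriv ::
    "real set \<Rightarrow> real set \<Rightarrow> (real \<Rightarrow> 'a::real_normed_vector) \<Rightarrow> real \<Rightarrow> 'a" where
  "delta_deriv \<T> S f t = (THE d. has_delta_deriv \<T> S f d t)"

definition regressive_on :: "real set \<Rightarrow> real set \<Rightarrow> (real \<Rightarrow> real^'n^'n) \<Rightarrow> bool" where
  "regressive_on \<T> S A \<longleftrightarrow> (\<forall>t\<in>S. invertible (mat 1 + (fwd_jump \<T> t - t) *\<^sub>R A t))"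


section \<open>Shift operators and periodicity in shifts\<close>

text \<open>Throughout, \<open>Ts\<close> is the subset of \<open>\<T>\<close> on which the shifts act, and \<open>\<delta>p\<close>, \<open>\<delta>m\<close> are the forward
  and backward shifts.  They are total HOL functions; where a shift is meaningful is recorded by
  its domain.\<close>

definition shift_dom ::
    "real set \<Rightarrow> real set \<Rightarrow> real \<Rightarrow> (real \<Rightarrow> real \<Rightarrow> real) \<Rightarrow> (real \<times> real) set" where
  "shift_dom \<T> Ts t0 \<delta> = {(s, t). s \<in> \<T> \<and> t0 \<le> s \<and> t \<in> Ts \<and> \<delta> s t \<in> Ts}"

text \<open>Strictness of the monotonicity in the second argument follows from the inversion laws.\<close>

locale shift_operators = time_scale \<T> for \<T> :: "real set" +
  fixes Ts :: "real set" and t0 :: real and \<delta>p \<delta>m :: "real \<Rightarrow> real \<Rightarrow> real"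
  assumes star_subset: "Ts \<subseteq> \<T>"
    and initial_point: "t0 \<in> Ts"
    and mono_p: "\<And>a t u. \<lbrakk>(a, t) \<in> shift_dom \<T> Ts t0 \<delta>p; (a, u) \<in> shift_dom \<T> Ts t0 \<delta>p; a \<le> t; t \<le> u\<rbrakk>
                   \<Longrightarrow> \<delta>p a t \<le> \<delta>p a u"
    and mono_m: "\<And>a t u. \<lbrakk>(a, t) \<in> shift_dom \<T> Ts t0 \<delta>m; (a, u) \<in> shift_dom \<T> Ts t0 \<delta>m; a \<le> t; t \<le> u\<rbrakk>
                   \<Longrightarrow> \<delta>m a t \<le> \<delta>m a u"
    and decreasing_m: "\<And>a b u. \<lbrakk>(a, u) \<in> shift_dom \<T> Ts t0 \<delta>m; (b, u) \<in> shift_dom \<T> Ts t0 \<delta>m; a < b\<rbrakk>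
                   \<Longrightarrow> \<delta>m a u > \<delta>m b u"
    and increasing_p: "\<And>a b u. \<lbrakk>(a, u) \<in> shift_dom \<T> Ts t0 \<delta>p; (b, u) \<in> shift_dom \<T> Ts t0 \<delta>p; a < b\<rbrakk>
                   \<Longrightarrow> \<delta>p a u < \<delta>p b u"
    and shift_initial: "\<And>t. \<lbrakk>t \<in> \<T>; t0 \<le> t\<rbrakk> \<Longrightarrow> (t, t0) \<in> shift_dom \<T> Ts t0 \<delta>p \<and> \<delta>p t t0 = t"
    and shift_by_initial: "\<And>t. t \<in> Ts \<Longrightarrow> (t0, t) \<in> shift_dom \<T> Ts t0 \<delta>p \<and> \<delta>p t0 t = t"
    and inverse_p: "\<And>a t. (a, t) \<in> shift_dom \<T> Ts t0 \<delta>p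
                   \<Longrightarrow> (a, \<delta>p a t) \<in> shift_dom \<T> Ts t0 \<delta>m \<and> \<delta>m a (\<delta>p a t) = t"
    and inverse_m: "\<And>a t. (a, t) \<in> shift_dom \<T> Ts t0 \<delta>m
                   \<Longrightarrow> (a, \<delta>m a t) \<in> shift_dom \<T> Ts t0 \<delta>p \<and> \<delta>p a (\<delta>m a t) = t"
    and commute_p: "\<And>a b t. \<lbrakk>(a, t) \<in> shift_dom \<T> Ts t0 \<delta>p; (b, \<delta>p a t) \<in> shift_dom \<T> Ts t0 \<delta>m\<rbrakk>
                   \<Longrightarrow> (a, \<delta>m b t) \<in> shift_dom \<T> Ts t0 \<delta>p \<and> \<delta>m b (\<delta>p a t) = \<delta>p a (\<delta>m b t)"
    and commute_m: "\<And>a b t. \<lbrakk>(a, t) \<in> shift_dom \<T> Ts t0 \<delta>m; (b, \<delta>m a t) \<in> shift_dom \<T> Ts t0 \<delta>p\<rbrakk>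
                   \<Longrightarrow> (a, \<delta>p b t) \<in> shift_dom \<T> Ts t0 \<delta>m \<and> \<delta>p b (\<delta>m a t) = \<delta>m a (\<delta>p b t)"

definition shift_total ::
    "real set \<Rightarrow> real set \<Rightarrow> real \<Rightarrow> (real \<Rightarrow> real \<Rightarrow> real) \<Rightarrow> (real \<Rightarrow> real \<Rightarrow> real) \<Rightarrow> real \<Rightarrow> bool" where
  "shift_total \<T> Ts t0 \<delta>p \<delta>m p \<longleftrightarrow>
     (\<forall>t\<in>Ts. (p, t) \<in> shift_dom \<T> Ts t0 \<delta>p \<and> (p, t) \<in> shift_dom \<T> Ts t0 \<delta>m)"

definition shift_period ::
    "real set \<Rightarrow> real set \<Rightarrow> real \<Rightarrow> (real \<Rightarrow> real \<Rightarrow> real) \<Rightarrow> (real \<Rightarrow> real \<Rightarrow> real) \<Rightarrow> real" where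
  "shift_period \<T> Ts t0 \<delta>p \<delta>m = Inf {p\<in>Ts. t0 < p \<and> shift_total \<T> Ts t0 \<delta>p \<delta>m p}"

text \<open>The time scale is periodic in shifts and its period exists as a number greater than \<open>t0\<close>.\<close>

definition periodic_time_scale ::
    "real set \<Rightarrow> real set \<Rightarrow> real \<Rightarrow> (real \<Rightarrow> real \<Rightarrow> real) \<Rightarrow> (real \<Rightarrow> real \<Rightarrow> real) \<Rightarrow> bool" where
  "periodic_time_scale \<T> Ts t0 \<delta>p \<delta>m \<longleftrightarrow>
     (\<exists>p\<in>Ts. t0 < p \<and> shift_total \<T> Ts t0 \<delta>p \<delta>m p) \<and> t0 < shift_period \<T> Ts t0 \<delta>p \<delta>m"

definition periodic_with ::
    "real set \<Rightarrow> (real \<Rightarrow> real \<Rightarrow> real) \<Rightarrow> (real \<Rightarrow> real \<Rightarrow> real) \<Rightarrow> real \<Rightarrow> (real \<Rightarrow> 'a) \<Rightarrow> bool" where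
  "periodic_with Ts \<delta>p \<delta>m T f \<longleftrightarrow> (\<forall>t\<in>Ts. f (\<delta>p T t) = f t \<and> f (\<delta>m T t) = f t)"

definition periodic_in_shifts ::
    "real set \<Rightarrow> real set \<Rightarrow> real \<Rightarrow> (real \<Rightarrow> real \<Rightarrow> real) \<Rightarrow> (real \<Rightarrow> real \<Rightarrow> real) \<Rightarrow>
     (real \<Rightarrow> 'a) \<Rightarrow> bool" where
  "periodic_in_shifts \<T> Ts t0 \<delta>p \<delta>m f \<longleftrightarrow>
     (\<exists>T\<in>Ts. shift_period \<T> Ts t0 \<delta>p \<delta>m \<le> T \<and> shift_total \<T> Ts t0 \<delta>p \<delta>m T \<and>
             periodic_with Ts \<delta>p \<delta>m T f)"

definition rd_differentiable_on ::
    "real set \<Rightarrow> real set \<Rightarrow> (real \<Rightarrow> 'a::real_normed_vector) \<Rightarrow> bool" where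
  "rd_differentiable_on \<T> S f \<longleftrightarrow>
     (\<forall>t\<in>S. \<exists>d. has_delta_deriv \<T> S f d t) \<and> rd_continuous_on \<T> S (delta_deriv \<T> S f)"

definition delta_periodic ::
    "real set \<Rightarrow> real set \<Rightarrow> real \<Rightarrow> (real \<Rightarrow> real \<Rightarrow> real) \<Rightarrow> (real \<Rightarrow> real \<Rightarrow> real) \<Rightarrow> real \<Rightarrow>
     (real \<Rightarrow> 'a::real_normed_vector) \<Rightarrow> bool" where
  "delta_periodic \<T> Ts t0 \<delta>p \<delta>m T f \<longleftrightarrow>
     shift_total \<T> Ts t0 \<delta>p \<delta>m T \<and>
     rd_differentiable_on \<T> Ts (\<delta>p T) \<and> rd_differentiable_on \<T> Ts (\<delta>m T) \<and>
     (\<forall>t\<in>Ts. delta_deriv \<T> Ts (\<delta>p T) t *\<^sub>R f (\<delta>p T t) = f t \<and>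
             delta_deriv \<T> Ts (\<delta>m T) t *\<^sub>R f (\<delta>m T t) = f t)"


section \<open>Spaces, norms and linear systems\<close>

text \<open>Continuity is what makes the maximum in the norm of this space meaningful.\<close>

definition periodic_space ::
    "real set \<Rightarrow> (real \<Rightarrow> real \<Rightarrow> real) \<Rightarrow> (real \<Rightarrow> real \<Rightarrow> real) \<Rightarrow> real \<Rightarrow> (real \<Rightarrow> real^'n) set" where
  "periodic_space Ts \<delta>p \<delta>m T = {x. continuous_on Ts x \<and> periodic_with Ts \<delta>p \<delta>m T x}"

text \<open>The maximum norm on the space of vectors is \<^const>\<open>infnorm\<close>.  The laws of shift operators alone
  only make the following a seminorm on \<^const>\<open>periodic_space\<close>: a point of \<open>Ts\<close> to the left of \<open>t0\<close>
  need not be a translate of a point of the interval.\<close>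

definition period_norm ::
    "real set \<Rightarrow> real \<Rightarrow> (real \<Rightarrow> real \<Rightarrow> real) \<Rightarrow> real \<Rightarrow> (real \<Rightarrow> real^'n) \<Rightarrow> real" where
  "period_norm \<T> t0 \<delta>p T x = (SUP t \<in> {t0..\<delta>p T t0} \<inter> \<T>. infnorm (x t))"

definition row_sum_norm :: "real^'n^'n \<Rightarrow> real" where
  "row_sum_norm M = Max (range (\<lambda>i. \<Sum>j\<in>UNIV. \<bar>M $ i $ j\<bar>))"

definition transition_matrix ::
    "real set \<Rightarrow> real set \<Rightarrow> real \<Rightarrow> (real \<Rightarrow> real^'n^'n) \<Rightarrow> (real \<Rightarrow> real^'n^'n) \<Rightarrow> bool" where
  "transition_matrix \<T> Ts t0 A \<Phi> \<longleftrightarrow>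
     \<Phi> t0 = mat 1 \<and> (\<forall>t\<in>Ts. has_delta_deriv \<T> Ts \<Phi> (A t ** \<Phi> t) t)"

definition noncritical ::
    "real set \<Rightarrow> real set \<Rightarrow> real \<Rightarrow> (real \<Rightarrow> real \<Rightarrow> real) \<Rightarrow> (real \<Rightarrow> real \<Rightarrow> real) \<Rightarrow>
     (real \<Rightarrow> real^'n^'n) \<Rightarrow> bool" where
  "noncritical \<T> Ts t0 \<delta>p \<delta>m A \<longleftrightarrow>
     (\<nexists>z::real \<Rightarrow> real^'n. (\<forall>t\<in>Ts. has_delta_deriv \<T> Ts z (A t *v z t) t) \<and>
        periodic_in_shifts \<T> Ts t0 \<delta>p \<delta>m z \<and> (\<exists>t\<in>Ts. z t \<noteq> 0))"

end

theory Submission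
  imports Defs
begin

text \<open>A period larger than \<open>t0\<close> forces the time scale to be discrete.  Since \<open>\<delta>p T t > t\<close>, continuity of
  \<open>\<delta>p T\<close> makes the set of points that are eventually shifted beyond \<open>t0\<close> both open and closed in \<open>Ts\<close>,
  so it is all of \<open>Ts\<close> because the norm separates points.  The shift laws then make every
  \<open>b \<ge> t0\<close> in the time scale a period, hence the infimum \<open>p > t0\<close> of the periods is the successor of
  \<open>t0\<close>, and \<open>Ts = {\<dots> < \<theta> (-1) < \<theta> 0 < \<theta> 1 < \<dots>}\<close> with every shift acting as a translation of the
  index.  The delay system becomes a neutral difference equation with periodic coefficients.

  Rewriting it with the Green function of the non-critical linear part, its solutions are the fixed
  points of an operator with Lipschitz constant \<open>\<kappa> = E1 + r L (\<parallel>A\<parallel> E1 + E2 + E3)\<close>, where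
  \<open>L = \<delta>p T t0 - t0\<close>.  The condition on \<open>J\<close> reads \<open>\<kappa> J + d \<le> J\<close> with
  \<open>d = \<alpha> + r L (\<parallel>A\<parallel> \<alpha> + \<beta>)\<close>, and nontriviality gives \<open>d > 0\<close>.  So \<open>\<kappa> < 1\<close>, and the contraction
  principle on the ball of radius \<open>J\<close> applies; no compactness argument is needed.\<close>

section \<open>Periodic linear difference equations\<close>

lemma infnorm_matrix_vector_le: "infnorm (M *v x) \<le> row_sum_norm M * infnorm (x :: real^'n)"
proof -
  have "\<bar>(M *v x) $ i\<bar> \<le> row_sum_norm M * infnorm x" for i
  proof -
    have "\<bar>(M *v x) $ i\<bar> \<le> (\<Sum>j\<in>UNIV. \<bar>M $ i $ j\<bar> * \<bar>x $ j\<bar>)"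
      unfolding matrix_vector_mult_def by (simp add: abs_mult[symmetric] sum_abs)
    also have "\<dots> \<le> (\<Sum>j\<in>UNIV. \<bar>M $ i $ j\<bar> * infnorm x)"
      by (intro sum_mono mult_left_mono component_le_infnorm_cart) auto
    also have "\<dots> \<le> row_sum_norm M * infnorm x"
      unfolding sum_distrib_right[symmetric] row_sum_norm_def
      by (intro mult_right_mono Max_ge) (auto simp: infnorm_pos_le)
    finally show ?thesis .
  qed
  then show ?thesis unfolding infnorm_cart[of "M *v x"] by (intro cSup_least) auto
qed

lemma row_sum_norm_nonneg: "0 \<le> row_sum_norm M"
proof -
  have "0 \<le> (\<Sum>j\<in>UNIV. \<bar>M $ undefined $ j\<bar>)" by (simp add: sum_nonneg)
  also have "\<dots> \<le> row_sum_norm M" unfolding row_sum_norm_def by (rule Max_ge) auto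
  finally show ?thesis .
qed

text \<open>A matrix of norm zero annihilates every vector, which an invertible matrix cannot do.
  Applied to a Green matrix, this makes the constant \<open>r\<close> strictly positive.\<close>

lemma row_sum_norm_pos: fixes M :: "real^'n^'n" assumes "invertible M" shows "0 < row_sum_norm M"
proof (rule ccontr)
  assume "\<not> ?thesis"
  then have z: "row_sum_norm M = 0" using row_sum_norm_nonneg[of M] by auto
  have "M *v x = 0" for x
    using infnorm_matrix_vector_le[of M x] infnorm_pos_lt[of "M *v x"] unfolding z by fastforce
  moreover obtain M' where "M' ** M = mat 1" using assms by (auto simp: invertible_def)
  ultimately have "(1 :: real^'n) = 0"
    by (metis matrix_vector_mul_assoc matrix_vector_mul_lid matrix_vector_mult_0_right)
  then show False by simp
qed

lemma matrix_inv_cancel: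
  fixes M :: "real^'n^'n" assumes "invertible M"
  shows "M ** matrix_inv M = mat 1" "matrix_inv M ** M = mat 1"
  using someI_ex[of "\<lambda>B. M ** B = mat 1 \<and> B ** M = mat 1"] assms
  unfolding invertible_def matrix_inv_def by blast+

lemma invertible_matrix_inv: "invertible M \<Longrightarrow> invertible (matrix_inv M)" for M :: "real^'n^'n"
  using matrix_inv_cancel unfolding invertible_def by blast

lemma matrix_inv_unique:
  fixes M :: "real^'n^'n" assumes "N ** M = mat 1" shows "matrix_inv M = N"
proof -
  have "invertible M" using assms invertible_left_inverse by blast
  then have "N ** (M ** matrix_inv M) = N" by (simp add: matrix_inv_cancel)
  then show ?thesis unfolding matrix_mul_assoc assms by simp
qed

lemma matrix_inv_mult:
  fixes M N :: "real^'n^'n" assumes "invertible M" "invertible N"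
  shows "matrix_inv (M ** N) = matrix_inv N ** matrix_inv M"
proof (rule matrix_inv_unique)
  have "matrix_inv N ** matrix_inv M ** (M ** N) = matrix_inv N ** (matrix_inv M ** M) ** N"
    by (simp only: matrix_mul_assoc)
  then show "matrix_inv N ** matrix_inv M ** (M ** N) = mat 1" using assms by (simp add: matrix_inv_cancel)
qed

lemma matrix_inv_involution: "invertible M \<Longrightarrow> matrix_inv (matrix_inv M) = M" for M :: "real^'n^'n"
  by (intro matrix_inv_unique matrix_inv_cancel)

lemma matrix_inv_vector:
  fixes M :: "real^'n^'n" assumes "invertible M"
  shows "M *v (matrix_inv M *v x) = x" "matrix_inv M *v (M *v x) = x"
  using assms by (simp_all add: matrix_vector_mul_assoc matrix_inv_cancel)

lemma interval_sum_shift: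
  fixes f :: "int \<Rightarrow> 'b::ab_group_add"
  assumes m_pos: "0 < m"
  shows "(\<Sum>i\<in>{k + 1..<k + 1 + m}. f i) = (\<Sum>i\<in>{k..<k + m}. f i) + f (k + m) - f k"
proof -
  have "{k..<k + 1 + m} = insert k {k + 1..<k + 1 + m}" "{k..<k + 1 + m} = insert (k + m) {k..<k + m}"
    using m_pos by auto
  then have "f k + (\<Sum>i\<in>{k + 1..<k + 1 + m}. f i) = f (k + m) + (\<Sum>i\<in>{k..<k + m}. f i)"
    by (metis (no_types, lifting) atLeastLessThan_iff finite_atLeastLessThan_int less_irrefl
        sum.insert zle_add1_eq_le not_le)
  then show ?thesis by (simp add: algebra_simps)
qed

text \<open>Moving the window by one step drops \<open>f k\<close> and adds the equal value
  \<open>f (k + m)\<close>.\<close>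

lemma interval_sum_period:
  fixes f :: "int \<Rightarrow> 'a::ab_group_add"
  assumes m_pos: "0 < m" and per: "\<And>i. f (i + m) = f i"
  shows "(\<Sum>i\<in>{k..<k + m}. f i) = (\<Sum>i\<in>{0..<m}. f i)"
proof (induction k rule: int_induct[of _ 0])
  case (step1 i) then show ?case unfolding interval_sum_shift[OF m_pos] per by simp
next
  case (step2 i) then show ?case using interval_sum_shift[OF m_pos, of f "i - 1"] per[of "i - 1"] by simp
qed simp

lemma infnorm_sum_le: "infnorm (\<Sum>i\<in>I. f i) \<le> (\<Sum>i\<in>I. infnorm (f i))"
proof (cases "finite I")
  case True
  then show ?thesis
  proof (induction I rule: finite_induct)
    case (insert i I)
    then show ?case using infnorm_triangle[of "f i" "sum f I"] by simp
  qed (simp add: infnorm_0)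
qed (simp add: infnorm_0)

section \<open>Floquet theory and the Green function\<close>

locale periodic_recurrence =
  fixes \<Phi> B :: "int \<Rightarrow> real^'n^'n" and m :: int
  assumes m_pos: "0 < m"
    and \<Phi>_0: "\<Phi> 0 = mat 1" and \<Phi>_step: "\<Phi> (k + 1) = B k ** \<Phi> k"
    and B_inv: "invertible (B k)" and B_periodic: "B (k + m) = B k"
begin

lemma \<Phi>_inv: "invertible (\<Phi> k)"
proof (induction k rule: int_induct[of _ 0])
  case base then show ?case by (auto simp: \<Phi>_0 invertible_def intro: exI[of _ "mat 1"])
next
  case (step1 i) then show ?case using invertible_mult B_inv \<Phi>_step by metis
next
  case (step2 i)
  have "\<Phi> i = B (i - 1) ** \<Phi> (i - 1)" using \<Phi>_step[of "i - 1"] by simp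
  then have "\<Phi> (i - 1) = matrix_inv (B (i - 1)) ** \<Phi> i"
    by (simp add: matrix_mul_assoc matrix_inv_cancel[OF B_inv])
  then show ?case using step2 invertible_matrix_inv[OF B_inv] invertible_mult by metis
qed

text \<open>Floquet's identity with monodromy matrix \<open>\<Phi> m\<close>: as functions of
  \<open>k\<close> both sides obey the same recurrence, because \<open>B\<close> is periodic, and
  they agree at \<open>k = 0\<close>. Invertibility of \<open>B\<close> carries the induction to
  negative \<open>k\<close>.\<close>

lemma \<Phi>_periodic: "\<Phi> (k + m) = \<Phi> k ** \<Phi> m"
proof (induction k rule: int_induct[of _ 0])
  case base then show ?case by (simp add: \<Phi>_0)
next
  case (step1 i)
  have "\<Phi> (i + 1 + m) = B (i + m) ** \<Phi> (i + m)" using \<Phi>_step[of "i + m"] by (simp add: algebra_simps)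
  also have "\<dots> = B i ** \<Phi> i ** \<Phi> m" by (simp add: B_periodic step1 matrix_mul_assoc)
  finally show ?case by (simp add: \<Phi>_step)
next
  case (step2 i)
  have "B (i - 1) ** \<Phi> (i - 1 + m) = \<Phi> (i + m)"
    using \<Phi>_step[of "i - 1 + m"] B_periodic[of "i - 1"] by (simp add: algebra_simps)
  also have "\<dots> = B (i - 1) ** (\<Phi> (i - 1) ** \<Phi> m)"
    using \<Phi>_step[of "i - 1"] by (simp add: step2 matrix_mul_assoc)
  finally have "matrix_inv (B (i - 1)) ** (B (i - 1) ** \<Phi> (i - 1 + m))
      = matrix_inv (B (i - 1)) ** (B (i - 1) ** (\<Phi> (i - 1) ** \<Phi> m))" by simp
  then show ?case by (simp add: matrix_mul_assoc matrix_inv_cancel[OF B_inv])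
qed

end

text \<open>A fixed vector \<open>v\<close> of the monodromy matrix is the initial value of the
  periodic solution \<open>\<Phi> k *v v\<close>, so \<open>no_periodic\<close> is non-criticality
  in algebraic form.\<close>

locale noncritical_recurrence = periodic_recurrence \<Phi> B m
  for \<Phi> B :: "int \<Rightarrow> real^'n^'n" and m +
  assumes no_periodic: "\<Phi> m *v v = v \<Longrightarrow> v = 0"
begin

abbreviation \<Psi> where "\<Psi> k \<equiv> matrix_inv (\<Phi> k)"
abbreviation R where "R \<equiv> matrix_inv (\<Psi> m - mat 1)"

lemma \<Psi>_periodic: "\<Psi> (k + m) = \<Psi> m ** \<Psi> k"
  unfolding \<Phi>_periodic by (rule matrix_inv_mult[OF \<Phi>_inv \<Phi>_inv])

text \<open>A kernel vector of \<open>\<Psi> m - mat 1\<close> is fixed by \<open>\<Psi> m\<close>,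
  hence by its inverse \<open>\<Phi> m\<close>.\<close>

lemma defect_inv: "invertible (\<Psi> m - mat 1)"
proof -
  have "v = 0" if "(\<Psi> m - mat 1) *v v = 0" for v
  proof (rule no_periodic)
    have "\<Psi> m *v v = v" using that by (simp add: matrix_vector_mult_diff_rdistrib)
    then show "\<Phi> m *v v = v" using matrix_inv_vector(1)[OF \<Phi>_inv, of m v] by simp
  qed
  then show ?thesis unfolding invertible_left_inverse matrix_left_invertible_ker by blast
qed

text \<open>The Green function of the periodic problem, in the form whose norm enters
  \<open>r\<close>. The index \<open>i + 1\<close> stands for the forward jump of the point with
  index \<open>i\<close>.\<close>

definition green where "green k i = matrix_inv (\<Phi> (i + 1) ** (\<Psi> m - mat 1) ** \<Psi> k)"

lemma green_eq: "green k i = \<Phi> k ** (R ** \<Psi> (i + 1))"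
  unfolding green_def
  by (simp add: matrix_inv_mult matrix_inv_involution \<Phi>_inv defect_inv invertible_mult invertible_matrix_inv)

lemma green_inv: "invertible (green k i)"
  unfolding green_eq by (intro invertible_mult invertible_matrix_inv \<Phi>_inv defect_inv)

text \<open>Variation of constants over one period: for periodic \<open>c\<close> this is the
  periodic solution of \<open>y (k + 1) = B k *v y k + c k\<close>.\<close>

definition response where "response c k = (\<Sum>i\<in>{k..<k + m}. green k i *v c i)"

lemma response_eq: "response c k = \<Phi> k *v (R *v (\<Sum>i\<in>{k..<k + m}. \<Psi> (i + 1) *v c i))"
  unfolding response_def green_eq
  by (simp add: matrix_vector_mul_assoc[symmetric] linear_sum[OF matrix_vector_mul_linear])

text \<open>Moving the window adds \<open>(\<Psi> m - mat 1) *v (\<Psi> (k + 1) *v c k)\<close> to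
  the sum. \<open>R\<close> removes the first factor and \<open>\<Phi> (k + 1)\<close> the second,
  which leaves \<open>c k\<close>.\<close>

lemma response_step:
  assumes per: "\<And>i. c (i + m) = c i"
  shows "response c (k + 1) = B k *v response c k + c k"
proof -
  let ?S = "\<lambda>k. \<Sum>i\<in>{k..<k + m}. \<Psi> (i + 1) *v c i"
  have e: "\<Psi> (k + m + 1) *v c (k + m) = \<Psi> m *v (\<Psi> (k + 1) *v c k)"
    using \<Psi>_periodic[of "k + 1"] per[of k] by (simp add: algebra_simps matrix_vector_mul_assoc)
  have "?S (k + 1) = ?S k + \<Psi> (k + m + 1) *v c (k + m) - \<Psi> (k + 1) *v c k"
    by (rule interval_sum_shift[OF m_pos])
  also have "\<dots> = ?S k + (\<Psi> m - mat 1) *v (\<Psi> (k + 1) *v c k)"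
    unfolding e by (simp add: matrix_vector_mult_diff_rdistrib)
  finally have "R *v ?S (k + 1) = R *v ?S k + \<Psi> (k + 1) *v c k"
    by (simp add: matrix_vector_right_distrib matrix_inv_vector[OF defect_inv])
  then have "\<Phi> (k + 1) *v (R *v ?S (k + 1)) = \<Phi> (k + 1) *v (R *v ?S k) + c k"
    by (simp only: matrix_vector_right_distrib matrix_inv_vector[OF \<Phi>_inv])
  also have "\<Phi> (k + 1) *v (R *v ?S k) = B k *v (\<Phi> k *v (R *v ?S k))"
    by (simp only: \<Phi>_step matrix_vector_mul_assoc matrix_mul_assoc)
  finally show ?thesis unfolding response_eq .
qed

text \<open>Moving the window by a full period multiplies the sum by \<open>\<Psi> m\<close>. This
  factor commutes with \<open>R\<close> and cancels against the factor \<open>\<Phi> m\<close> of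
  \<open>\<Phi> (k + m)\<close>.\<close>

lemma response_periodic:
  assumes per: "\<And>i. c (i + m) = c i"
  shows "response c (k + m) = response c k"
proof -
  let ?S = "\<lambda>k. \<Sum>i\<in>{k..<k + m}. \<Psi> (i + 1) *v c i"
  have "?S (k + m) = (\<Sum>i\<in>{k..<k + m}. \<Psi> (i + m + 1) *v c (i + m))"
    by (rule sum.reindex_bij_witness[of _ "\<lambda>i. i + m" "\<lambda>i. i - m"]) auto
  also have "\<dots> = (\<Sum>i\<in>{k..<k + m}. \<Psi> m *v (\<Psi> (i + 1) *v c i))"
    using \<Psi>_periodic[of "_ + 1"] by (simp add: per algebra_simps matrix_vector_mul_assoc)
  also have "\<dots> = \<Psi> m *v ?S k" by (simp add: linear_sum[OF matrix_vector_mul_linear])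
  finally have S: "?S (k + m) = \<Psi> m *v ?S k" .
  \<comment> \<open>\<open>R\<close> inherits commutation with \<open>\<Psi> m\<close> from its
    inverse \<open>\<Psi> m - mat 1\<close>.\<close>
  have "(\<Psi> m - mat 1) *v (\<Psi> m *v (R *v ?S k)) = \<Psi> m *v ((\<Psi> m - mat 1) *v (R *v ?S k))"
    by (simp add: matrix_vector_mult_diff_rdistrib matrix_vector_mult_diff_distrib)
  also have "\<dots> = \<Psi> m *v ?S k" by (simp add: matrix_inv_vector[OF defect_inv])
  finally have "R *v ((\<Psi> m - mat 1) *v (\<Psi> m *v (R *v ?S k))) = R *v (\<Psi> m *v ?S k)"
    by (rule arg_cong)
  then have "R *v (\<Psi> m *v ?S k) = \<Psi> m *v (R *v ?S k)"
    unfolding matrix_inv_vector(2)[OF defect_inv] by (rule sym)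
  then show ?thesis unfolding response_eq S \<Phi>_periodic
    by (simp add: matrix_vector_mul_assoc[symmetric] matrix_inv_vector[OF \<Phi>_inv])
qed

text \<open>Each Green matrix costs at most \<open>r\<close>, and periodicity moves the window to
  \<open>{0..<m}\<close>. With the graininess as weight \<open>\<mu>\<close>, the sum becomes the
  length of one period.\<close>

lemma response_bound:
  fixes c :: "int \<Rightarrow> real^'n"
  assumes per: "\<And>i. c (i + m) = c i"
    and green: "\<And>i. i \<in> {k..<k + m} \<Longrightarrow> row_sum_norm (green k i) \<le> r"
    and bound: "\<And>i. i \<in> {0..<m} \<Longrightarrow> infnorm (c i) \<le> \<mu> i * C"
  shows "infnorm (response c k) \<le> r * (\<Sum>i\<in>{0..<m}. \<mu> i) * C"
proof -
  have r: "0 \<le> r" using green[of k] m_pos row_sum_norm_nonneg[of "green k k"] by auto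
  have "infnorm (response c k) \<le> (\<Sum>i\<in>{k..<k + m}. infnorm (green k i *v c i))"
    unfolding response_def by (rule infnorm_sum_le)
  also have "\<dots> \<le> (\<Sum>i\<in>{k..<k + m}. r * infnorm (c i))"
    by (intro sum_mono order_trans[OF infnorm_matrix_vector_le] mult_right_mono green infnorm_pos_le)
  also have "\<dots> = r * (\<Sum>i\<in>{k..<k + m}. infnorm (c i))" by (simp add: sum_distrib_left)
  also have "\<dots> = r * (\<Sum>i\<in>{0..<m}. infnorm (c i))"
    using interval_sum_period[OF m_pos, of "\<lambda>i. infnorm (c i)" k] per by simp
  also have "\<dots> \<le> r * (\<Sum>i\<in>{0..<m}. \<mu> i * C)" by (intro mult_left_mono sum_mono bound r)
  finally show ?thesis by (simp add: sum_distrib_right mult.assoc)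
qed

end


section \<open>Periodic neutral difference equations\<close>

lemma geometric_convergence:
  fixes x :: "nat \<Rightarrow> real^'n"
  assumes "0 \<le> \<kappa>" "\<kappa> < 1" "\<And>n. infnorm (x (Suc n) - x n) \<le> \<kappa> ^ n * D"
  shows "convergent x"
proof -
  \<comment> \<open>The dimension factor passes from the maximum norm to the Euclidean norm.\<close>
  let ?C = "sqrt (real DIM(real^'n)) * D"
  have "norm (x (Suc n) - x n) \<le> ?C * \<kappa> ^ n" for n
  proof -
    have "norm (x (Suc n) - x n) \<le> sqrt (real DIM(real^'n)) * infnorm (x (Suc n) - x n)"
      by (rule norm_le_infnorm)
    also have "\<dots> \<le> sqrt (real DIM(real^'n)) * (\<kappa> ^ n * D)" by (intro mult_left_mono assms(3)) auto
    finally show ?thesis by (simp add: algebra_simps)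
  qed
  moreover have "summable (\<lambda>n. ?C * \<kappa> ^ n)" using assms by (intro summable_mult summable_geometric) auto
  ultimately have "summable (\<lambda>n. x (Suc n) - x n)" by (rule summable_comparison_test'[where N = 0, rotated])
  then have "convergent (\<lambda>n. \<Sum>i<n. x (Suc i) - x i)" by (simp add: summable_iff_convergent)
  then have "convergent (\<lambda>n. (x n - x 0) + x 0)"
    unfolding sum_lessThan_telescope by (intro convergent_add convergent_const)
  then show ?thesis by simp
qed

lemma infnorm_le_diff: "infnorm x \<le> infnorm (x - y) + infnorm y"
  using infnorm_triangle[of "x - y" y] by simp

definition int_periodic :: "int \<Rightarrow> (int \<Rightarrow> 'a) \<Rightarrow> bool" where
  "int_periodic m x \<longleftrightarrow> (\<forall>k. x (k + m) = x k)"

text \<open>Both ends are included because \<open>period_norm\<close> runs over a closed interval,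
  whose points have the indices \<open>0\<close> to \<open>m\<close>. Arguments such as
  \<open>\<lambda>k. Q (\<theta> k) 0\<close> are measured on the same set.\<close>

definition cycle_norm :: "int \<Rightarrow> (int \<Rightarrow> 'a::euclidean_space) \<Rightarrow> real" where
  "cycle_norm m x = (SUP k\<in>{0..m}. infnorm (x k))"

lemma int_periodic_diff: "int_periodic m x \<Longrightarrow> int_periodic m y \<Longrightarrow> int_periodic m (\<lambda>k. x k - y k)"
  by (simp add: int_periodic_def)

lemma int_periodicD: "int_periodic m x \<Longrightarrow> x (k + m) = x k"
  by (simp add: int_periodic_def)

lemma int_periodic_representative:
  assumes "0 < m" "int_periodic m x"
  shows "\<exists>i\<in>{0..<m}. x k = x i"
proof -
  have *: "x (i + int n * m) = x i" for n i
  proof (induction n)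
    case (Suc n)
    have "x (i + int (Suc n) * m) = x (i + int n * m + m)" by (simp add: algebra_simps)
    then show ?case using Suc assms by (simp add: int_periodic_def)
  qed simp
  have "x k = x (k mod m)"
  proof (cases "0 \<le> k div m")
    case True
    then show ?thesis using *[of "k mod m" "nat (k div m)"] by (simp add: mod_div_mult_eq add.commute)
  next
    case False
    \<comment> \<open>For a negative quotient it is \<open>k\<close> that is moved forward, namely
      to \<open>k mod m\<close>.\<close>
    have "k - (k div m) * m = k mod m" by (simp add: minus_div_mult_eq_mod)
    then show ?thesis using False *[of k "nat (- (k div m))"] by simp
  qed
  then show ?thesis using assms by (intro bexI[of _ "k mod m"]) auto
qed

lemma infnorm_le_cycle_norm: "k \<in> {0..m} \<Longrightarrow> infnorm (x k) \<le> cycle_norm m x"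
  unfolding cycle_norm_def by (intro cSUP_upper) auto

lemma infnorm_le_cycle_norm_all:
  assumes "0 < m" "int_periodic m x"
  shows "infnorm (x k) \<le> cycle_norm m x"
proof -
  obtain i where i: "i \<in> {0..<m}" "x k = x i" using int_periodic_representative[OF assms] by blast
  show ?thesis unfolding i(2) using i(1) by (intro infnorm_le_cycle_norm) auto
qed

lemma cycle_norm_le: "0 < m \<Longrightarrow> (\<And>k. k \<in> {0..m} \<Longrightarrow> infnorm (x k) \<le> C) \<Longrightarrow> cycle_norm m x \<le> C"
  unfolding cycle_norm_def by (intro cSUP_least) auto

text \<open>Picard iteration from the zero sequence, with limits taken at each index. The
  \<open>ball\<close> condition keeps the iterates in the ball of radius \<open>J\<close>;
  periodicity extends the Lipschitz bound from one cycle to all indices.\<close>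

lemma cycle_contraction:
  fixes H :: "(int \<Rightarrow> real^'n) \<Rightarrow> int \<Rightarrow> real^'n"
  assumes m: "0 < m" and \<kappa>: "0 \<le> \<kappa>" "\<kappa> < 1"
    and H: "\<And>x. int_periodic m x \<Longrightarrow> int_periodic m (H x)"
    and lip: "\<And>x y k. \<lbrakk>int_periodic m x; int_periodic m y; k \<in> {0..m}\<rbrakk> \<Longrightarrow>
        infnorm (H x k - H y k) \<le> \<kappa> * cycle_norm m (\<lambda>i. x i - y i)"
    and ball: "\<And>k. k \<in> {0..m} \<Longrightarrow> \<kappa> * J + infnorm (H (\<lambda>_. 0) k) \<le> J" and J: "0 \<le> J"
  shows "\<exists>x. int_periodic m x \<and> cycle_norm m x \<le> J \<and> H x = x"
proof -
  define X where "X n = (H ^^ n) (\<lambda>_. 0)" for n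
  have XS: "X (Suc n) = H (X n)" for n by (simp add: X_def)
  have per: "int_periodic m (X n)" for n
    by (induction n) (auto simp: X_def H, simp add: int_periodic_def)
  have lip_all: "infnorm (H x k - H y k) \<le> \<kappa> * cycle_norm m (\<lambda>i. x i - y i)"
    if xy: "int_periodic m x" "int_periodic m y" for x y k
  proof -
    obtain i where i: "i \<in> {0..<m}" "H x k - H y k = H x i - H y i"
      using int_periodic_representative[OF m int_periodic_diff[OF H[OF xy(1)] H[OF xy(2)]]] by blast
    show ?thesis unfolding i(2) using i(1) xy by (intro lip) auto
  qed
  have normX: "cycle_norm m (X n) \<le> J" for n
  proof (induction n)
    case 0 show ?case using J by (intro cycle_norm_le m) (simp add: X_def infnorm_0)
  next
    case (Suc n)
    show ?case unfolding XS
    proof (rule cycle_norm_le[OF m])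
      fix k assume k: "k \<in> {0..m}"
      have "infnorm (H (X n) k - H (\<lambda>_. 0) k) \<le> \<kappa> * cycle_norm m (\<lambda>i. X n i - 0)"
        by (intro lip per k) (simp add: int_periodic_def)
      also have "\<dots> \<le> \<kappa> * J" using Suc \<kappa> by (intro mult_left_mono) auto
      finally show "infnorm (H (X n) k) \<le> J"
        using infnorm_le_diff[of "H (X n) k" "H (\<lambda>_. 0) k"] ball[OF k] by linarith
    qed
  qed
  let ?D = "cycle_norm m (\<lambda>i. X 1 i - X 0 i)"
  have step: "cycle_norm m (\<lambda>i. X (Suc n) i - X n i) \<le> \<kappa> ^ n * ?D" for n
  proof (induction n)
    case (Suc n)
    have "cycle_norm m (\<lambda>i. X (Suc (Suc n)) i - X (Suc n) i) \<le> \<kappa> * cycle_norm m (\<lambda>i. X (Suc n) i - X n i)"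
      unfolding XS[of "Suc n"] by (subst (2) XS, rule cycle_norm_le[OF m]) (intro lip per)
    also have "\<dots> \<le> \<kappa> * (\<kappa> ^ n * ?D)" using Suc \<kappa> by (intro mult_left_mono) auto
    finally show ?case by (simp add: algebra_simps)
  qed simp
  have "convergent (\<lambda>n. X n k)" for k
    using order_trans[OF infnorm_le_cycle_norm_all[OF m int_periodic_diff[OF per per]] step]
    by (rule geometric_convergence[OF \<kappa>])
  then obtain x where x: "\<And>k. (\<lambda>n. X n k) \<longlonglongrightarrow> x k" unfolding convergent_def by metis
  have perx: "int_periodic m x"
    unfolding int_periodic_def
  proof
    fix k
    have "X n (k + m) = X n k" for n using per[of n] by (rule int_periodicD)
    then show "x (k + m) = x k" using x[of "k + m"] x[of k] LIMSEQ_unique by auto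
  qed
  have "cycle_norm m x \<le> J"
  proof (rule cycle_norm_le[OF m])
    fix k assume "k \<in> {0..m}"
    then have "infnorm (X n k) \<le> J" for n using infnorm_le_cycle_norm normX order_trans by blast
    then show "infnorm (x k) \<le> J" using tendsto_infnorm[OF x[of k]] by (intro LIMSEQ_le_const2) auto
  qed
  moreover have "H x k = x k" for k
  proof -
    \<comment> \<open>The cycle norm is dominated by a finite sum over the cycle, so convergence at
      each index suffices to pass to the limit in \<open>H\<close>.\<close>
    have "(\<lambda>n. \<kappa> * (\<Sum>i\<in>{0..m}. infnorm (X n i - x i))) \<longlonglongrightarrow> \<kappa> * (\<Sum>i\<in>{0..m}. infnorm (x i - x i))"
      by (intro tendsto_intros x)
    then have lim: "(\<lambda>n. \<kappa> * (\<Sum>i\<in>{0..m}. infnorm (X n i - x i))) \<longlonglongrightarrow> 0" by (simp add: infnorm_0)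
    have "infnorm (X (Suc n) k - H x k) \<le> \<kappa> * (\<Sum>i\<in>{0..m}. infnorm (X n i - x i))" for n
    proof -
      have "infnorm (X (Suc n) k - H x k) \<le> \<kappa> * cycle_norm m (\<lambda>i. X n i - x i)"
        unfolding XS by (intro lip_all per perx)
      also have "\<dots> \<le> \<kappa> * (\<Sum>i\<in>{0..m}. infnorm (X n i - x i))"
        by (intro mult_left_mono \<kappa> cycle_norm_le m member_le_sum) (auto simp: infnorm_pos_le)
      finally show ?thesis .
    qed
    moreover have "(\<lambda>n. infnorm (X (Suc n) k - H x k)) \<longlonglongrightarrow> infnorm (x k - H x k)"
      by (intro tendsto_intros LIMSEQ_Suc x)
    ultimately have "infnorm (x k - H x k) \<le> 0" using lim by (intro LIMSEQ_le) auto
    then show "H x k = x k" using infnorm_pos_lt[of "x k - H x k"] by auto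
  qed
  ultimately show ?thesis using perx by blast
qed

text \<open>Writing \<open>x = q + y\<close> with \<open>q\<close> the neutral term absorbs its
  difference: \<open>y\<close> solves the linear recurrence with forcing \<open>\<mu> k\<close>
  times \<open>A k *v q k + g k\<close>. Hence the periodic solutions sought are fixed points of
  \<open>H x = q x + response (c x)\<close>, a contraction that preserves the ball of radius
  \<open>J\<close>.\<close>

lemma (in noncritical_recurrence) neutral_periodic_solution:
  fixes A :: "int \<Rightarrow> real^'n^'n" and \<mu> :: "int \<Rightarrow> real" and Q :: "int \<Rightarrow> real^'n \<Rightarrow> real^'n"
    and G :: "int \<Rightarrow> real^'n \<Rightarrow> real^'n \<Rightarrow> real^'n" and j :: int and E1 E2 E3 r a \<alpha> \<beta> J :: real
  defines "L \<equiv> \<Sum>i\<in>{0..<m}. \<mu> i"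
  assumes B_eq: "\<And>k. B k = mat 1 + \<mu> k *\<^sub>R A k" and \<mu>: "\<And>k. 0 < \<mu> k"
    and Q_periodic: "\<And>x k. int_periodic m x \<Longrightarrow> Q (k + m) (x (k + m - j)) = Q k (x (k - j))"
    and G_periodic: "\<And>x k. int_periodic m x \<Longrightarrow>
        \<mu> (k + m) *\<^sub>R G (k + m) (x (k + m)) (x (k + m - j)) = \<mu> k *\<^sub>R G k (x k) (x (k - j))"
    and Q_Lipschitz: "\<And>x y k. \<lbrakk>int_periodic m x; int_periodic m y\<rbrakk> \<Longrightarrow>
        infnorm (Q k (x (k - j)) - Q k (y (k - j))) \<le> E1 * cycle_norm m (\<lambda>i. x i - y i)"
    and G_Lipschitz: "\<And>x y k. \<lbrakk>int_periodic m x; int_periodic m y\<rbrakk> \<Longrightarrow>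
        infnorm (G k (x k) (x (k - j)) - G k (y k) (y (k - j))) \<le> (E2 + E3) * cycle_norm m (\<lambda>i. x i - y i)"
    and E: "0 \<le> E1" "0 \<le> E2" "0 \<le> E3"
    and a: "\<And>k. k \<in> {0..<m} \<Longrightarrow> row_sum_norm (A k) \<le> a"
    and r: "\<And>k i. k \<in> {0..m} \<Longrightarrow> i \<in> {k..<k + m} \<Longrightarrow> row_sum_norm (green k i) \<le> r"
    and \<alpha>: "\<And>k. k \<in> {0..m} \<Longrightarrow> infnorm (Q k 0) \<le> \<alpha>"
    and \<beta>: "\<And>k. k \<in> {0..m} \<Longrightarrow> infnorm (G k 0 0) \<le> \<beta>"
    and nontrivial: "\<exists>k. Q (k + 1) 0 - Q k 0 + \<mu> k *\<^sub>R G k 0 0 \<noteq> 0"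
    and J: "0 < J" "E1 * J + \<alpha> + r * L * (a * (\<alpha> + E1 * J) + (E2 + E3) * J + \<beta>) \<le> J"
  shows "\<exists>x. int_periodic m x \<and> cycle_norm m x \<le> J \<and>
    (\<forall>k. x (k + 1) - x k = \<mu> k *\<^sub>R (A k *v x k) + (Q (k + 1) (x (k + 1 - j)) - Q k (x (k - j)))
       + \<mu> k *\<^sub>R G k (x k) (x (k - j)))"
proof -
  have B_A: "B k *v v = v + \<mu> k *\<^sub>R (A k *v v)" for k v
    by (simp add: B_eq matrix_vector_mult_add_rdistrib scaleR_matrix_vector_assoc)
  \<comment> \<open>\<open>\<mu>\<close> and \<open>A\<close> need not be periodic separately; their
    product is, being \<open>B k - mat 1\<close>.\<close>
  have A_periodic: "\<mu> (k + m) *\<^sub>R (A (k + m) *v v) = \<mu> k *\<^sub>R (A k *v v)" for k v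
    using B_periodic[of k] B_A[of "k + m" v] B_A[of k v] by simp
  have a0: "0 \<le> a" using a[of 0] row_sum_norm_nonneg[of "A 0"] m_pos by auto
  \<comment> \<open>Strict positivity comes from the invertibility of a single Green matrix; it is
    used below to infer \<open>\<beta> = 0\<close>.\<close>
  have r0: "0 < r" using r[of 0 0] row_sum_norm_pos[OF green_inv, of 0 0] m_pos by auto
  have L0: "0 < L" unfolding L_def using m_pos \<mu> by (intro sum_pos) auto
  have \<alpha>0: "0 \<le> \<alpha>" using \<alpha>[of 0] infnorm_pos_le[of "Q 0 0"] m_pos by auto
  have \<beta>0: "0 \<le> \<beta>" using \<beta>[of 0] infnorm_pos_le[of "G 0 0 0"] m_pos by auto
  define q where "q x k = Q k (x (k - j))" for x :: "int \<Rightarrow> real^'n" and k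
  define g where "g x k = G k (x k) (x (k - j))" for x :: "int \<Rightarrow> real^'n" and k
  define c where "c x k = \<mu> k *\<^sub>R (A k *v q x k) + \<mu> k *\<^sub>R g x k" for x :: "int \<Rightarrow> real^'n" and k
  define H where "H x k = q x k + response (c x) k" for x :: "int \<Rightarrow> real^'n" and k
  have q_per: "q x (k + m) = q x k" if "int_periodic m x" for x k
    using Q_periodic[OF that] by (simp add: q_def)
  have c_per: "c x (k + m) = c x k" if "int_periodic m x" for x k
    using G_periodic[OF that] by (simp add: c_def g_def q_per[OF that] A_periodic)
  have zero: "int_periodic m (\<lambda>_. 0 :: real^'n)" by (simp add: int_periodic_def)
  define \<kappa> where "\<kappa> = E1 + r * L * (a * E1 + (E2 + E3))"
  define d where "d = \<alpha> + r * L * (a * \<alpha> + \<beta>)"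
  have Jd: "\<kappa> * J + d \<le> J" using J(2) by (simp add: \<kappa>_def d_def algebra_simps)
  \<comment> \<open>This estimate serves twice: for differences of two sequences it yields the
    Lipschitz constant of \<open>H\<close>, and at the zero sequence it yields
    \<open>d\<close>.\<close>
  have aff: "infnorm (response c' k) \<le> r * L * (a * e + f)"
    if "\<And>i. c' (i + m) = c' i" "k \<in> {0..m}"
      "\<And>i. c' i = \<mu> i *\<^sub>R (A i *v u i) + \<mu> i *\<^sub>R v i"
      "\<And>i. i \<in> {0..<m} \<Longrightarrow> infnorm (u i) \<le> e" "\<And>i. i \<in> {0..<m} \<Longrightarrow> infnorm (v i) \<le> f"
    for c' u v :: "int \<Rightarrow> real^'n" and e f k
    unfolding L_def
  proof (rule response_bound[where c = c', OF that(1)])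
    fix i assume i: "i \<in> {0..<m}"
    have "infnorm (c' i) = \<mu> i * infnorm (A i *v u i + v i)"
      using \<mu>[of i] by (simp add: that(3) scaleR_right_distrib[symmetric] infnorm_mul)
    also have "\<dots> \<le> \<mu> i * (infnorm (A i *v u i) + infnorm (v i))"
      using \<mu>[of i] by (intro mult_left_mono infnorm_triangle) auto
    also have "infnorm (A i *v u i) \<le> a * e"
      using infnorm_matrix_vector_le[of "A i" "u i"] that(4)[OF i] a[OF i] a0 infnorm_pos_le[of "u i"]
      by (meson mult_mono order_trans)
    finally show "infnorm (c' i) \<le> \<mu> i * (a * e + f)"
      using \<mu>[of i] that(5)[OF i] by (smt (verit) mult_left_mono)
  qed (use r that(2) in auto)
  have "\<kappa> < 1"
  proof -
    \<comment> \<open>If \<open>d\<close> were not positive, \<open>\<alpha>\<close> and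
      \<open>\<beta>\<close> would vanish, and periodicity would make the forcing at zero vanish at
      every index, against nontriviality. With \<open>d > 0\<close>, the condition on
      \<open>J\<close> forces \<open>\<kappa> < 1\<close>.\<close>
    have "0 < d"
    proof (rule ccontr)
      assume "\<not> ?thesis"
      moreover have "0 \<le> r * L * (a * \<alpha>)" "0 \<le> r * L * \<beta>" using r0 L0 a0 \<alpha>0 \<beta>0 by auto
      ultimately have "\<alpha> \<le> 0" "r * L * \<beta> \<le> 0" using \<alpha>0 by (simp_all add: d_def algebra_simps)
      then have "\<alpha> = 0" "\<beta> = 0" using \<alpha>0 \<beta>0 r0 L0 by (auto simp: mult_le_0_iff)
      then have z: "Q k 0 = 0" "G k 0 0 = 0" if "k \<in> {0..m}" for k
        using \<alpha>[OF that] \<beta>[OF that] infnorm_pos_lt[of "Q k 0"] infnorm_pos_lt[of "G k 0 0"] by auto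
      have "int_periodic m (\<lambda>k. Q k 0)" "int_periodic m (\<lambda>k. \<mu> k *\<^sub>R G k 0 0)"
        using Q_periodic[OF zero] G_periodic[OF zero] by (simp_all add: int_periodic_def)
      then have "Q k 0 = 0" "\<mu> k *\<^sub>R G k 0 0 = 0" for k
        using int_periodic_representative[OF m_pos] z by fastforce+
      then show False using nontrivial by auto
    qed
    then have "\<kappa> * J < 1 * J" using Jd by simp
    then show ?thesis using J(1) by simp
  qed
  moreover have "0 \<le> \<kappa>" unfolding \<kappa>_def using E a0 r0 L0 by auto
  moreover have "int_periodic m (H x)" if "int_periodic m x" for x
    using response_periodic[of "c x"] by (simp add: int_periodic_def H_def q_per[OF that] c_per[OF that])
  moreover have "infnorm (H x k - H y k) \<le> \<kappa> * cycle_norm m (\<lambda>i. x i - y i)"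
    if xy: "int_periodic m x" "int_periodic m y" "k \<in> {0..m}" for x y k
  proof -
    let ?n = "cycle_norm m (\<lambda>i. x i - y i)"
    have "response (c x) k - response (c y) k = response (\<lambda>i. c x i - c y i) k"
      by (simp add: response_def sum_subtractf[symmetric] matrix_vector_mult_diff_distrib)
    then have "H x k - H y k = (q x k - q y k) + response (\<lambda>i. c x i - c y i) k"
      by (simp add: H_def)
    moreover have "infnorm (response (\<lambda>i. c x i - c y i) k) \<le> r * L * (a * (E1 * ?n) + (E2 + E3) * ?n)"
    proof (rule aff[where u = "\<lambda>i. q x i - q y i" and v = "\<lambda>i. g x i - g y i"])
      show "c x i - c y i = \<mu> i *\<^sub>R (A i *v (q x i - q y i)) + \<mu> i *\<^sub>R (g x i - g y i)" for i
        by (simp add: c_def matrix_vector_mult_diff_distrib scaleR_right_diff_distrib)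
    qed (use xy in \<open>simp_all add: c_per Q_Lipschitz G_Lipschitz q_def g_def\<close>)
    moreover have "infnorm (q x k - q y k) \<le> E1 * ?n" using xy by (simp add: q_def Q_Lipschitz)
    moreover have "\<kappa> * ?n = E1 * ?n + r * L * (a * (E1 * ?n) + (E2 + E3) * ?n)"
      by (simp add: \<kappa>_def algebra_simps)
    ultimately show ?thesis using infnorm_triangle[of "q x k - q y k"] by (smt (verit))
  qed
  moreover have "\<kappa> * J + infnorm (H (\<lambda>_. 0) k) \<le> J" if k: "k \<in> {0..m}" for k
  proof -
    have "infnorm (response (c (\<lambda>_. 0)) k) \<le> r * L * (a * \<alpha> + \<beta>)"
    proof (rule aff[where u = "q (\<lambda>_. 0)" and v = "g (\<lambda>_. 0)"])
      show "c (\<lambda>_. 0) (i + m) = c (\<lambda>_. 0) i" for i by (rule c_per[OF zero])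
      show "c (\<lambda>_. 0) i = \<mu> i *\<^sub>R (A i *v q (\<lambda>_. 0) i) + \<mu> i *\<^sub>R g (\<lambda>_. 0) i" for i
        by (rule c_def)
    qed (use k in \<open>simp_all add: \<alpha> \<beta> q_def g_def\<close>)
    moreover have "infnorm (q (\<lambda>_. 0) k) \<le> \<alpha>" using \<alpha>[OF k] by (simp add: q_def)
    ultimately have "infnorm (H (\<lambda>_. 0) k) \<le> d"
      using infnorm_triangle[of "q (\<lambda>_. 0) k" "response (c (\<lambda>_. 0)) k"] by (simp add: H_def d_def)
    then show ?thesis using Jd by linarith
  qed
  ultimately obtain x where x: "int_periodic m x" "cycle_norm m x \<le> J" "H x = x"
    using cycle_contraction[OF m_pos, of \<kappa> H J] J(1) by auto
  have "x (k + 1) - x k = \<mu> k *\<^sub>R (A k *v x k) + (Q (k + 1) (x (k + 1 - j)) - Q k (x (k - j)))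
       + \<mu> k *\<^sub>R G k (x k) (x (k - j))" for k
  proof -
    \<comment> \<open>The fixed point splits as \<open>q x + ?y\<close>; the recurrence for
      \<open>?y\<close> turns back into the neutral equation.\<close>
    let ?y = "response (c x)"
    have xk: "x k = q x k + ?y k" for k using fun_cong[OF x(3), of k] by (simp add: H_def)
    have "?y (k + 1) = ?y k + \<mu> k *\<^sub>R (A k *v ?y k) + c x k"
      using response_step[of "c x" k] c_per[OF x(1)] by (simp add: B_A)
    then have "x (k + 1) - x k = q x (k + 1) - q x k + (\<mu> k *\<^sub>R (A k *v ?y k) + c x k)"
      unfolding xk[of "k + 1"] xk[of k] by simp
    also have "\<mu> k *\<^sub>R (A k *v ?y k) + c x k = \<mu> k *\<^sub>R (A k *v (q x k + ?y k)) + \<mu> k *\<^sub>R g x k"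
      unfolding c_def[of x k] by (simp add: matrix_vector_right_distrib scaleR_right_distrib)
    also have "q x k + ?y k = x k" by (rule xk[symmetric])
    finally show ?thesis by (simp add: q_def g_def)
  qed
  then show ?thesis using x by blast
qed


section \<open>Discreteness of periodic time scales\<close>

text \<open>Continuity, neighbourhoods and jumps inside \<open>Ts\<close> will come from delta
  differentiability of \<open>\<delta>p T\<close>. \<open>no_detached_part\<close> expresses that
  the norm separates points: the indicator function of such a set \<open>V\<close> is periodic,
  continuous and of norm zero.\<close>

locale periodic_shifts = shift_operators +
  fixes T :: real
  assumes T_star: "T \<in> Ts" and T_gt: "t0 < T"
    and T_total: "shift_total \<T> Ts t0 \<delta>p \<delta>m T"
    and T_cont: "continuous_on Ts (\<delta>p T)"
    and star_nbhd: "\<And>t. t \<in> Ts \<Longrightarrow> \<exists>\<eta>>0. \<forall>u\<in>\<T>. \<bar>u - t\<bar> < \<eta> \<longrightarrow> u \<in> Ts"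
    and jump_star: "\<And>t. t \<in> Ts \<Longrightarrow> fwd_jump \<T> t \<in> Ts"
    and no_detached_part: "\<And>V. \<lbrakk>openin (top_of_set Ts) V; closedin (top_of_set Ts) V;
          \<And>t. t \<in> Ts \<Longrightarrow> \<delta>p T t \<in> V \<longleftrightarrow> t \<in> V; V \<inter> {t0..} = {}\<rbrakk> \<Longrightarrow> V = {}"
    and period_gt: "t0 < shift_period \<T> Ts t0 \<delta>p \<delta>m"
begin

section \<open>Consequences of the shift laws\<close>

abbreviation "Dp \<equiv> shift_dom \<T> Ts t0 \<delta>p"
abbreviation "Dm \<equiv> shift_dom \<T> Ts t0 \<delta>m"
abbreviation "M \<equiv> \<T> \<inter> {t0..}"

text \<open>Every such \<open>a\<close> is the shift \<open>\<delta>p a t0\<close>, and shifts take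
  values in \<open>Ts\<close>.\<close>

lemma M_star: "a \<in> M \<Longrightarrow> a \<in> Ts"
  using shift_initial[of a] by (auto simp: shift_dom_def)

lemma t0_M: "t0 \<in> M" and T_M: "T \<in> M"
  using initial_point star_subset T_star T_gt by auto

lemma Dp_I: "a \<in> M \<Longrightarrow> t \<in> Ts \<Longrightarrow> \<delta>p a t \<in> Ts \<Longrightarrow> (a, t) \<in> Dp"
  and Dm_I: "a \<in> M \<Longrightarrow> t \<in> Ts \<Longrightarrow> \<delta>m a t \<in> Ts \<Longrightarrow> (a, t) \<in> Dm"
  by (auto simp: shift_dom_def)

lemma Dp_D: "(a, t) \<in> Dp \<Longrightarrow> a \<in> M \<and> t \<in> Ts \<and> \<delta>p a t \<in> Ts"
  and Dm_D: "(a, t) \<in> Dm \<Longrightarrow> a \<in> M \<and> t \<in> Ts \<and> \<delta>m a t \<in> Ts"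
  by (auto simp: shift_dom_def)

lemma shift_p_t0: "a \<in> M \<Longrightarrow> (a, t0) \<in> Dp \<and> \<delta>p a t0 = a"
  using shift_initial by auto

lemma shift_m_self: "a \<in> M \<Longrightarrow> (a, a) \<in> Dm \<and> \<delta>m a a = t0"
  using inverse_p[of a t0] shift_p_t0[of a] by auto

text \<open>Commuting the shifts gives \<open>\<delta>m a (\<delta>p b a) = \<delta>p b (\<delta>m a
  a) = \<delta>p b t0 = b\<close>; then \<open>\<delta>p a\<close> is applied.\<close>

lemma shift_p_M:
  assumes "a \<in> M" "b \<in> M"
  shows "(b, a) \<in> Dp" "\<delta>p b a = \<delta>p a b"
proof -
  have *: "(a, \<delta>p b a) \<in> Dm \<and> \<delta>p b (\<delta>m a a) = \<delta>m a (\<delta>p b a)"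
    by (rule commute_m) (simp_all only: shift_m_self[OF assms(1)] shift_p_t0[OF assms(2)])
  then show "(b, a) \<in> Dp" using Dp_I Dm_D assms M_star by blast
  have "\<delta>m a (\<delta>p b a) = b" using * shift_m_self[OF assms(1)] shift_p_t0[OF assms(2)] by metis
  then show "\<delta>p b a = \<delta>p a b" using * inverse_m[of a "\<delta>p b a"] by metis
qed

text \<open>The commutation law for \<open>\<delta>m a (\<delta>p a t0)\<close> puts
  \<open>\<delta>m a t0\<close> into \<open>Ts\<close>.\<close>

lemma shift_m_t0: "a \<in> M \<Longrightarrow> (a, t0) \<in> Dm"
  using commute_p[of a t0 a] shift_m_self[of a] shift_p_t0[of a] Dp_D Dm_I initial_point by metis

lemma T_dom: "t \<in> Ts \<Longrightarrow> (T, t) \<in> Dp" "t \<in> Ts \<Longrightarrow> (T, t) \<in> Dm"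
  using T_total by (auto simp: shift_total_def)

lemma T_star_p [simp]: "t \<in> Ts \<Longrightarrow> \<delta>p T t \<in> Ts" and T_star_m [simp]: "t \<in> Ts \<Longrightarrow> \<delta>m T t \<in> Ts"
  using T_dom Dp_D Dm_D by blast+

lemma T_inv [simp]: "t \<in> Ts \<Longrightarrow> \<delta>p T (\<delta>m T t) = t" "t \<in> Ts \<Longrightarrow> \<delta>m T (\<delta>p T t) = t"
  using T_dom inverse_p inverse_m by blast+

lemma shift_p_gt:
  assumes "(a, t) \<in> Dp" "t0 < a" shows "t < \<delta>p a t"
  using increasing_p[of t0 t a] shift_by_initial[of t] assms Dp_D by auto

lemma shift_m_T:
  assumes "(b, t) \<in> Dp"
  shows "(b, \<delta>m T t) \<in> Dp" "\<delta>m T (\<delta>p b t) = \<delta>p b (\<delta>m T t)"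
  using commute_p[of b t T] assms T_dom Dp_D by blast+

lemma pow_T_star: "t \<in> Ts \<Longrightarrow> (\<delta>p T ^^ n) t \<in> Ts" "t \<in> Ts \<Longrightarrow> (\<delta>m T ^^ n) t \<in> Ts"
  by (induction n) auto

lemma pow_T_inv: "t \<in> Ts \<Longrightarrow> (\<delta>m T ^^ n) ((\<delta>p T ^^ n) t) = t"
proof (induction n arbitrary: t)
  case (Suc n)
  have "(\<delta>m T ^^ Suc n) ((\<delta>p T ^^ Suc n) t) = \<delta>m T ((\<delta>m T ^^ n) ((\<delta>p T ^^ n) (\<delta>p T t)))"
    by (simp add: funpow_swap1)
  then show ?case using Suc by simp
qed auto

text \<open>This turns the point \<open>x\<close> into a shift amount. Monotonicity in the second
  argument is available only for \<open>a \<le> t\<close>, whereas monotonicity in the first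
  argument now orders the backward iterates of all points of \<open>M\<close>.\<close>

lemma shift_p_pow:
  assumes "x \<in> M"
  shows "(x, (\<delta>m T ^^ n) t0) \<in> Dp \<and> \<delta>p x ((\<delta>m T ^^ n) t0) = (\<delta>m T ^^ n) x"
proof (induction n)
  case 0 then show ?case using shift_p_t0 assms by auto
next
  case (Suc n) then show ?case using shift_m_T[of x "(\<delta>m T ^^ n) t0"] by auto
qed

lemma pow_m_mono:
  assumes "x \<in> M" "y \<in> M" "x \<le> y"
  shows "(\<delta>m T ^^ n) x \<le> (\<delta>m T ^^ n) y"
  using shift_p_pow[OF assms(1), of n] shift_p_pow[OF assms(2), of n] assms(3)
    increasing_p[of x "(\<delta>m T ^^ n) t0" y] by (cases "x = y") auto

lemma pow_m_strict_mono:
  assumes "x \<in> M" "y \<in> M" "x < y"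
  shows "(\<delta>m T ^^ n) x < (\<delta>m T ^^ n) y"
  using shift_p_pow[OF assms(1), of n] shift_p_pow[OF assms(2), of n] assms(3)
    increasing_p[of x "(\<delta>m T ^^ n) t0" y] by auto

lemma shift_diff_M:
  assumes "(a, t) \<in> Dm" "a \<le> t" shows "\<delta>m a t \<in> M"
  using mono_m[of a a t] shift_m_self[of a] assms Dm_D star_subset by auto

lemma pow_m_t0_decreasing: "m \<le> n \<Longrightarrow> (\<delta>m T ^^ n) t0 \<le> (\<delta>m T ^^ m) t0"
proof (induction n rule: dec_induct)
  case (step n)
  have "\<delta>m T ((\<delta>m T ^^ n) t0) < (\<delta>m T ^^ n) t0"
    using shift_p_gt[OF T_dom(1), of "(\<delta>m T ^^ Suc n) t0"] T_gt pow_T_star(2)[OF initial_point] by auto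
  then show ?case using step by auto
qed auto

section \<open>Every point is eventually shifted beyond \<open>t0\<close>\<close>

definition reach where "reach = {t \<in> Ts. \<exists>n. t0 \<le> (\<delta>p T ^^ n) t}"

lemma pow_p_increasing:
  assumes "t \<in> Ts" "m \<le> n" shows "(\<delta>p T ^^ m) t \<le> (\<delta>p T ^^ n) t"
  using assms(2)
proof (induction n rule: dec_induct)
  case (step n)
  then show ?case using shift_p_gt[OF T_dom(1)[OF pow_T_star(1)[OF assms(1), of n]] T_gt] by auto
qed auto

lemma pow_p_cont: "continuous_on Ts (\<delta>p T ^^ n)"
proof (induction n)
  case (Suc n)
  then show ?case
    using continuous_on_compose2[OF T_cont, of Ts "\<delta>p T ^^ n"] pow_T_star by (auto simp: o_def)
qed (auto intro: continuous_on_id)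

text \<open>The number of shifts is controlled by the position of \<open>t\<close>. For
  \<open>n \<le> m\<close>, if the iterate of order \<open>m + 1\<close> were below
  \<open>T\<close>, shifting back would put \<open>t\<close> strictly below the \<open>m\<close>-th,
  hence below the \<open>n\<close>-th, backward iterate of \<open>t0\<close>. So one shift can be
  undone without leaving \<open>M\<close>.\<close>

lemma reach_early:
  assumes "t \<in> Ts" "t0 \<le> (\<delta>p T ^^ m) t" "(\<delta>m T ^^ n) t0 \<le> t"
  shows "t0 \<le> (\<delta>p T ^^ n) t"
  using assms(2)
proof (induction m)
  case 0
  then show ?case using pow_p_increasing[OF assms(1), of 0 n] by auto
next
  case (Suc m)
  show ?case
  proof (cases "m < n")
    case True
    then show ?thesis using pow_p_increasing[OF assms(1), of "Suc m" n] Suc by auto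
  next
    case False
    let ?x = "(\<delta>p T ^^ Suc m) t"
    have x: "?x \<in> M" using Suc pow_T_star[OF assms(1), of "Suc m"] star_subset by auto
    have "T \<le> ?x"
    proof (rule ccontr)
      assume "\<not> ?thesis"
      then have "(\<delta>m T ^^ Suc m) ?x < (\<delta>m T ^^ Suc m) T"
        by (intro pow_m_strict_mono[OF x T_M]) simp
      also have "(\<delta>m T ^^ Suc m) T = (\<delta>m T ^^ m) t0"
        using shift_m_self[OF T_M] by (simp add: funpow_Suc_right del: funpow.simps(2))
      also have "\<dots> \<le> (\<delta>m T ^^ n) t0" using False pow_m_t0_decreasing by auto
      finally show False using assms(3) unfolding pow_T_inv[OF assms(1)] by linarith
    qed
    then have "\<delta>m T ?x \<in> M" using shift_diff_M T_dom M_star[OF x] by blast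
    then have "t0 \<le> (\<delta>p T ^^ m) t" using assms(1) pow_T_star(1)[OF assms(1), of m] by auto
    then show ?thesis by (rule Suc.IH)
  qed
qed

lemma pow_m_t0_le:
  assumes "t \<in> Ts" "t0 \<le> (\<delta>p T ^^ n) t" shows "(\<delta>m T ^^ n) t0 \<le> t"
proof -
  have "(\<delta>p T ^^ n) t \<in> M" using assms pow_T_star star_subset by auto
  from pow_m_mono[OF t0_M this, of n] assms show ?thesis by (auto simp: pow_T_inv)
qed

text \<open>The points never shifted beyond \<open>t0\<close> form a shift-invariant set that is
  open and closed in \<open>Ts\<close> and lies left of \<open>t0\<close>, so
  \<open>no_detached_part\<close> makes it empty.\<close>

lemma reach_all: "\<exists>n. t0 \<le> (\<delta>p T ^^ n) t" if "t \<in> Ts"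
proof -
  let ?V = "Ts - reach"
  have "openin (top_of_set Ts) reach"
  proof -
    \<comment> \<open>One further shift makes the inequality strict, so \<open>reach\<close> is a
      union of preimages of an open ray.\<close>
    have eq: "reach = (\<Union>n. Ts \<inter> (\<delta>p T ^^ n) -` {t0<..})"
    proof (intro set_eqI iffI)
      fix t assume "t \<in> reach"
      then obtain n where n: "t \<in> Ts" "t0 \<le> (\<delta>p T ^^ n) t" by (auto simp: reach_def)
      then have "t0 < (\<delta>p T ^^ Suc n) t"
        using shift_p_gt[OF T_dom(1)[OF pow_T_star(1)[OF n(1), of n]] T_gt] by auto
      then show "t \<in> (\<Union>n. Ts \<inter> (\<delta>p T ^^ n) -` {t0<..})" using n by blast
    qed (auto simp: reach_def intro: less_imp_le)
    show ?thesis unfolding eq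
      by (intro openin_Union) (auto intro: continuous_openin_preimage_gen pow_p_cont)
  qed
  then have closed: "closedin (top_of_set Ts) ?V" by (auto simp: closedin_def reach_def double_diff)
  have op: "openin (top_of_set Ts) ?V"
    unfolding openin_euclidean_subtopology_iff
  proof (intro conjI ballI)
    fix w assume w: "w \<in> ?V"
    show "\<exists>e>0. \<forall>x'\<in>Ts. dist x' w < e \<longrightarrow> x' \<in> ?V"
    proof (rule ccontr)
      assume "\<not> ?thesis"
      then have near: "\<exists>t\<in>reach. dist t w < e" if "e > 0" for e
        using that by (metis DiffI)
      have wT: "w \<in> Ts" using w by auto
      \<comment> \<open>If \<open>w\<close> were above the \<open>n\<close>-th backward iterate of
        \<open>t0\<close>, so would be the nearby reached points. By \<open>reach_early\<close> they
        all pass \<open>t0\<close> after \<open>n\<close> shifts, which continuity at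
        \<open>w\<close> excludes.\<close>
      have lower: "w \<le> (\<delta>m T ^^ n) t0" for n
      proof (rule ccontr)
        assume "\<not> ?thesis"
        moreover
        have "(\<delta>p T ^^ n) w < t0" using w by (auto simp: reach_def not_le)
        then obtain e where e: "e > 0" "\<And>t. t \<in> Ts \<Longrightarrow> dist t w < e \<Longrightarrow>
            dist ((\<delta>p T ^^ n) t) ((\<delta>p T ^^ n) w) < t0 - (\<delta>p T ^^ n) w"
          using pow_p_cont[of n, unfolded continuous_on_iff, rule_format, OF wT, of "t0 - (\<delta>p T ^^ n) w"]
          by auto
        ultimately obtain t where t: "t \<in> reach" "dist t w < min e (w - (\<delta>m T ^^ n) t0)"
          using near[of "min e (w - (\<delta>m T ^^ n) t0)"] by auto
        then have "(\<delta>m T ^^ n) t0 \<le> t" by (auto simp: dist_real_def)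
        then have "t0 \<le> (\<delta>p T ^^ n) t" using t reach_early by (auto simp: reach_def)
        then show False using e(2)[of t] t by (auto simp: reach_def dist_real_def)
      qed
      \<comment> \<open>Each reached point near \<open>w\<close> has a backward iterate of
        \<open>t0\<close> below it, so these decreasing iterates converge to \<open>w\<close>. By
        continuity \<open>w\<close> would be a fixed point of \<open>\<delta>p T\<close>, although
        shifting by \<open>T\<close> strictly increases.\<close>
      have "(\<lambda>n. (\<delta>m T ^^ n) t0) \<longlonglongrightarrow> w"
      proof (rule LIMSEQ_I)
        fix e :: real assume "e > 0"
        then obtain t n where t: "t \<in> Ts" "t0 \<le> (\<delta>p T ^^ n) t" "dist t w < e"
          using near[of e] by (auto simp: reach_def)
        then have "(\<delta>m T ^^ n) t0 < w + e" using pow_m_t0_le[of t n] by (auto simp: dist_real_def)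
        then have "\<forall>k\<ge>n. norm ((\<delta>m T ^^ k) t0 - w) < e"
          using lower pow_m_t0_decreasing[of n] by (smt (verit) real_norm_def)
        then show "\<exists>n. \<forall>k\<ge>n. norm ((\<delta>m T ^^ k) t0 - w) < e" by blast
      qed
      then have l: "(\<lambda>n. (\<delta>m T ^^ Suc n) t0) \<longlonglongrightarrow> w" and l': "(\<lambda>n. (\<delta>m T ^^ n) t0) \<longlonglongrightarrow> w"
        using LIMSEQ_Suc by blast+
      have "(\<lambda>n. \<delta>p T ((\<delta>m T ^^ Suc n) t0)) \<longlonglongrightarrow> \<delta>p T w"
        using T_cont l wT pow_T_star(2)[OF initial_point]
        by (intro continuous_on_tendsto_compose[OF T_cont l]) (auto simp del: funpow.simps)
      then have "\<delta>p T w = w"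
        using l' pow_T_star(2)[OF initial_point] LIMSEQ_unique by fastforce
      then show False using shift_p_gt[OF T_dom(1)[OF wT] T_gt] by auto
    qed
  qed auto
  have "?V = {}"
  proof (rule no_detached_part[OF op closed])
    fix t assume t: "t \<in> Ts"
    have "\<delta>p T t \<in> reach \<longleftrightarrow> t \<in> reach"
    proof
      assume "\<delta>p T t \<in> reach"
      then obtain n where "t0 \<le> (\<delta>p T ^^ Suc n) t"
        by (auto simp: reach_def funpow_swap1)
      then show "t \<in> reach" using t unfolding reach_def by blast
    next
      assume "t \<in> reach"
      then obtain n where "t0 \<le> (\<delta>p T ^^ n) t" by (auto simp: reach_def)
      then have "t0 \<le> (\<delta>p T ^^ Suc n) t" using pow_p_increasing[OF t, of n "Suc n"] by auto
      then have "t0 \<le> (\<delta>p T ^^ n) (\<delta>p T t)" by (simp add: funpow_swap1)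
      then show "\<delta>p T t \<in> reach" using t by (auto simp: reach_def)
    qed
    then show "\<delta>p T t \<in> ?V \<longleftrightarrow> t \<in> ?V" using t by auto
  next
    have "t \<in> reach" if "t \<in> Ts" "t0 \<le> t" for t
      using that unfolding reach_def by (auto intro: exI[of _ 0])
    then show "?V \<inter> {t0..} = {}" by auto
  qed
  then show "\<exists>n. t0 \<le> (\<delta>p T ^^ n) t" using that by (auto simp: reach_def)
qed

text \<open>By \<open>reach_all\<close> every point arises from a point of \<open>M\<close> by
  finitely many backward shifts by \<open>T\<close>.\<close>

lemma star_induct:
  assumes "t \<in> Ts" "\<And>x. x \<in> M \<Longrightarrow> R x" "\<And>u. u \<in> Ts \<Longrightarrow> R u \<Longrightarrow> R (\<delta>m T u)"
  shows "R t"
proof -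
  obtain n where n: "t0 \<le> (\<delta>p T ^^ n) t" using reach_all assms(1) by blast
  let ?x = "(\<delta>p T ^^ n) t"
  have x: "?x \<in> M" "?x \<in> Ts" using n assms(1) pow_T_star star_subset by auto
  have "R ((\<delta>m T ^^ k) ?x)" for k by (induction k) (use assms(2)[OF x(1)] assms(3) x pow_T_star in auto)
  from this[of n] show ?thesis using pow_T_inv[OF assms(1)] by auto
qed

lemma total_p: "b \<in> M \<Longrightarrow> t \<in> Ts \<Longrightarrow> (b, t) \<in> Dp"
  by (rule star_induct[of t]) (auto intro: shift_p_M shift_m_T)

text \<open>A point \<open>x\<close> of \<open>M\<close> is \<open>\<delta>p x t0\<close>, and
  \<open>\<delta>m b\<close> commutes with \<open>\<delta>p x\<close>; backward shifts by
  \<open>T\<close> are handled by commutation as well. With \<open>total_p\<close>, every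
  \<open>b > t0\<close> in \<open>M\<close> competes in the infimum that defines the period.\<close>

lemma total_m:
  assumes "b \<in> M" "t \<in> Ts" shows "(b, t) \<in> Dm"
  using assms(2)
proof (rule star_induct)
  fix x assume x: "x \<in> M"
  have "(b, \<delta>p x t0) \<in> Dm"
    using commute_m[of b t0 x] shift_m_t0[OF assms(1)] total_p[OF x] Dm_D by blast
  then show "(b, x) \<in> Dm" using shift_p_t0[OF x] by auto
next
  fix u assume u: "u \<in> Ts" "(b, u) \<in> Dm"
  then have "(T, \<delta>m b (\<delta>m T u)) \<in> Dp"
    using commute_p[of T "\<delta>m T u" b] T_dom by auto
  then show "(b, \<delta>m T u) \<in> Dm" using Dm_I[OF assms(1)] Dp_D u by auto
qed

lemma shift_star [simp]: "b \<in> M \<Longrightarrow> t \<in> Ts \<Longrightarrow> \<delta>p b t \<in> Ts" "b \<in> M \<Longrightarrow> t \<in> Ts \<Longrightarrow> \<delta>m b t \<in> Ts"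
  using total_p total_m Dp_D Dm_D by blast+

lemma shift_inv [simp]:
  "b \<in> M \<Longrightarrow> t \<in> Ts \<Longrightarrow> \<delta>p b (\<delta>m b t) = t" "b \<in> M \<Longrightarrow> t \<in> Ts \<Longrightarrow> \<delta>m b (\<delta>p b t) = t"
  using total_p total_m inverse_p inverse_m by blast+

lemma shift_commute:
  assumes "a \<in> M" "b \<in> M" "t \<in> Ts"
  shows "\<delta>p a (\<delta>m b t) = \<delta>m b (\<delta>p a t)" "\<delta>p a (\<delta>p b t) = \<delta>p b (\<delta>p a t)"
proof -
  have *: "\<delta>p a (\<delta>m b t) = \<delta>m b (\<delta>p a t)" if "t \<in> Ts" for t
    using commute_p[of a t b] total_p total_m assms that by auto
  show "\<delta>p a (\<delta>m b t) = \<delta>m b (\<delta>p a t)" using * assms by auto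
  have "\<delta>p a t = \<delta>m b (\<delta>p a (\<delta>p b t))" using *[of "\<delta>p b t"] assms by auto
  then show "\<delta>p a (\<delta>p b t) = \<delta>p b (\<delta>p a t)" using assms by auto
qed

definition p where "p = shift_period \<T> Ts t0 \<delta>p \<delta>m"

text \<open>By totality the admissible periods are exactly the points of \<open>\<T>\<close> beyond
  \<open>t0\<close>. As their infimum exceeds \<open>t0\<close>, they form the closed set
  \<open>\<T> \<inter> {p..}\<close>, so the infimum is attained and is the successor of
  \<open>t0\<close>.\<close>

lemma p_props: "p \<in> M" "t0 < p" "\<And>x. x \<in> M \<Longrightarrow> t0 < x \<Longrightarrow> p \<le> x"
proof -
  have eq: "{p\<in>Ts. t0 < p \<and> shift_total \<T> Ts t0 \<delta>p \<delta>m p} = {x \<in> \<T>. t0 < x}"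
    using M_star star_subset total_p total_m by (auto simp: shift_total_def)
  then have p: "p = Inf {x \<in> \<T>. t0 < x}" by (auto simp: p_def shift_period_def)
  have bdd: "bdd_below {x \<in> \<T>. t0 < x}" by (auto intro: bdd_belowI[of _ t0])
  show pg: "t0 < p" using period_gt by (simp add: p_def)
  show le: "\<And>x. x \<in> M \<Longrightarrow> t0 < x \<Longrightarrow> p \<le> x" unfolding p by (rule cInf_lower) (auto intro: bdd)
  have "{x \<in> \<T>. t0 < x} = \<T> \<inter> {p..}" using le pg by auto
  moreover have "closed (\<T> \<inter> {p..})" using closed by auto
  ultimately have "p \<in> \<T> \<inter> {p..}" unfolding p
    using closed_contains_Inf[of "{x \<in> \<T>. t0 < x}"] bdd T_M T_gt p by auto
  then show "p \<in> M" using pg by auto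
qed

section \<open>Enumeration of \<open>Ts\<close> by the integers\<close>

definition \<theta> :: "int \<Rightarrow> real" where
  "\<theta> k = (if 0 \<le> k then (\<delta>p p ^^ nat k) t0 else (\<delta>m p ^^ nat (- k)) t0)"

lemma \<theta>_0: "\<theta> 0 = t0" by (simp add: \<theta>_def)

lemma \<theta>_star [simp]: "\<theta> k \<in> Ts"
proof -
  have "(\<delta>p p ^^ n) t0 \<in> Ts" "(\<delta>m p ^^ n) t0 \<in> Ts" for n
    by (induction n) (use p_props initial_point in auto)
  then show ?thesis by (auto simp: \<theta>_def)
qed

lemma \<theta>_step: "\<theta> (k + 1) = \<delta>p p (\<theta> k)"
proof (cases "0 \<le> k")
  case True
  then have "nat (k + 1) = Suc (nat k)" by auto
  then show ?thesis using True by (auto simp: \<theta>_def)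
next
  case False
  then have "nat (- k) = Suc (nat (- (k + 1)))" by auto
  then have k: "\<theta> k = \<delta>m p (\<theta> (k + 1))" using False by (auto simp: \<theta>_def)
  show ?thesis unfolding k using p_props by auto
qed

lemma \<theta>_back: "\<theta> (k - 1) = \<delta>m p (\<theta> k)"
  using \<theta>_step[of "k - 1"] p_props by auto

lemma \<theta>_less_step: "\<theta> k < \<theta> (k + 1)"
  unfolding \<theta>_step by (rule shift_p_gt[OF total_p[OF p_props(1) \<theta>_star] p_props(2)])

lemma \<theta>_strict_mono: "strict_mono \<theta>"
proof (rule strict_monoI)
  fix a b :: int assume "a < b"
  then show "\<theta> a < \<theta> b"
  proof (induction b rule: int_gr_induct)
    case (step i) then show ?case using \<theta>_less_step[of i] by auto
  qed (rule \<theta>_less_step)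
qed

lemma \<theta>_less [simp]: "\<theta> a < \<theta> b \<longleftrightarrow> a < b" and \<theta>_le [simp]: "\<theta> a \<le> \<theta> b \<longleftrightarrow> a \<le> b"
  and \<theta>_eq [simp]: "\<theta> a = \<theta> b \<longleftrightarrow> a = b"
  using \<theta>_strict_mono strict_mono_less strict_mono_less_eq strict_mono_eq by blast+

text \<open>\<open>y\<close> is \<open>x\<close> shifted by \<open>?d\<close>, a point of
  \<open>M\<close> other than \<open>t0\<close>, hence at least \<open>p\<close>.\<close>

lemma gap_M:
  assumes "x \<in> M" "y \<in> M" "x < y" shows "\<delta>p p x \<le> y"
proof -
  let ?d = "\<delta>m x y"
  have d: "?d \<in> M" using shift_diff_M[OF total_m[OF assms(1)]] assms M_star by auto
  have y: "\<delta>p x ?d = y" using assms M_star by auto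
  moreover have "\<delta>p x t0 = x" using shift_p_t0 assms by auto
  ultimately have "?d \<noteq> t0" using assms by auto
  then have "p \<le> ?d" using p_props d by auto
  then have "\<delta>p p x \<le> \<delta>p ?d x"
    using increasing_p[OF total_p total_p, of p x ?d] p_props(1) d M_star[OF assms(1)] by (cases "p = ?d") auto
  then show ?thesis using y shift_p_M(2)[OF assms(1) d] by auto
qed

lemma \<theta>_M: "0 \<le> k \<Longrightarrow> \<theta> k \<in> M"
  using \<theta>_le[of 0 k] \<theta>_star[of k] star_subset by (auto simp: \<theta>_0)

text \<open>A point missed by the enumeration would bound it, so the points
  \<open>\<theta> n\<close> would increase to some \<open>L\<close> in the closed set
  \<open>M\<close>. The predecessor \<open>\<delta>m p L\<close> is below some
  \<open>\<theta> n\<close>, and \<open>gap_M\<close> then gives \<open>L \<le> \<theta> n\<close>,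
  a contradiction.\<close>

lemma M_\<theta>:
  assumes "x \<in> M" shows "\<exists>k\<ge>0. x = \<theta> k"
proof (rule ccontr)
  assume "\<not> ?thesis"
  then have ne: "\<And>k. 0 \<le> k \<Longrightarrow> x \<noteq> \<theta> k" by auto
  have lt: "\<theta> (int n) < x" for n
  proof (induction n)
    case 0 then show ?case using assms ne[of 0] by (auto simp: \<theta>_0)
  next
    case (Suc n)
    have "\<theta> (int n + 1) \<le> x" unfolding \<theta>_step using gap_M \<theta>_M assms Suc by auto
    then show ?case using ne[of "int (Suc n)"] by (auto simp: add.commute)
  qed
  have "incseq (\<lambda>n. \<theta> (int n))" by (auto intro!: monoI)
  moreover have "\<forall>n. \<theta> (int n) \<le> x" using lt by (auto intro: less_imp_le)
  ultimately obtain L where L: "(\<lambda>n. \<theta> (int n)) \<longlonglongrightarrow> L" "\<And>n. \<theta> (int n) \<le> L"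
    using incseq_convergent[of "\<lambda>n. \<theta> (int n)" x] by blast
  have LM: "L \<in> M" using closed_sequentially[of M "\<lambda>n. \<theta> (int n)" L] \<theta>_M closed L by auto
  have lt': "\<theta> (int n) < L" for n
    using L(2)[of "Suc n"] \<theta>_less[of "int n" "int (Suc n)"] by linarith
  define u where "u = \<delta>m p L"
  have "p \<le> L" using L(2)[of 1] \<theta>_step[of 0] shift_p_t0[of p] p_props by (auto simp: \<theta>_0)
  then have u: "u \<in> M" "\<delta>p p u = L" "u \<in> Ts"
    using shift_diff_M[OF total_m, of p L] p_props M_star[OF LM] M_star by (auto simp: u_def)
  have "u < L" using shift_p_gt[OF total_p[OF p_props(1) u(3)]] p_props u by auto
  then have "\<forall>\<^sub>F n in sequentially. u < \<theta> (int n)" using L(1) order_tendstoD(1) by blast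
  then obtain n where "u < \<theta> (int n)" unfolding eventually_sequentially by blast
  then have "L \<le> \<theta> (int n)" using gap_M[OF u(1) \<theta>_M[of "int n"]] u by auto
  then show False using lt'[of n] by auto
qed

definition idx :: "real \<Rightarrow> int" where "idx b = (THE k. b = \<theta> k)"

lemma idx_\<theta> [simp]: "idx (\<theta> k) = k" by (auto simp: idx_def)

lemma \<theta>_idx_M: "b \<in> M \<Longrightarrow> \<theta> (idx b) = b \<and> 0 \<le> idx b" using M_\<theta> by fastforce

text \<open>Since \<open>\<delta>p b\<close> commutes with the shifts by \<open>p\<close>, it is
  determined by its value \<open>b\<close> at \<open>t0\<close>.\<close>

lemma shift_p_\<theta>: assumes "b \<in> M" shows "\<delta>p b (\<theta> k) = \<theta> (k + idx b)"
proof (induction k rule: int_induct[of _ 0])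
  case base then show ?case using shift_p_t0[OF assms] \<theta>_idx_M[OF assms] by (auto simp: \<theta>_0)
next
  case (step1 i)
  have "\<delta>p b (\<theta> (i + 1)) = \<delta>p p (\<delta>p b (\<theta> i))"
    unfolding \<theta>_step using shift_commute(2)[OF assms p_props(1)] by auto
  then show ?case unfolding step1 by (simp add: \<theta>_step[symmetric] algebra_simps)
next
  case (step2 i)
  have "\<delta>p b (\<theta> (i - 1)) = \<delta>m p (\<delta>p b (\<theta> i))"
    unfolding \<theta>_back using shift_commute(1)[OF assms p_props(1)] by auto
  then show ?case unfolding step2 by (simp add: \<theta>_back[symmetric] algebra_simps)
qed

lemma shift_m_\<theta>: assumes "b \<in> M" shows "\<delta>m b (\<theta> k) = \<theta> (k - idx b)"
  using shift_p_\<theta>[OF assms, of "k - idx b"] shift_inv(2)[OF assms \<theta>_star, of "k - idx b"] by auto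

lemma star_\<theta>: "t \<in> Ts \<Longrightarrow> \<exists>k. t = \<theta> k"
proof (rule star_induct[of t])
  fix u assume "u \<in> Ts" "\<exists>k. u = \<theta> k" then show "\<exists>k. \<delta>m T u = \<theta> k" using shift_m_\<theta>[OF T_M] by auto
qed (use M_\<theta> in auto)

lemma ball_star_iff: "(\<forall>t\<in>Ts. R t) \<longleftrightarrow> (\<forall>k. R (\<theta> k))" using star_\<theta> by fastforce

text \<open>Isolation is needed in \<open>\<T>\<close>, not only in \<open>Ts\<close>: the
  neighbourhood condition first brings nearby points into \<open>Ts\<close>, where the two
  neighbours in the enumeration bound the gap.\<close>

lemma isolated: "\<exists>\<eta>>0. \<forall>u\<in>\<T>. \<bar>u - \<theta> k\<bar> < \<eta> \<longrightarrow> u = \<theta> k"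
proof -
  obtain \<eta> where \<eta>: "\<eta> > 0" "\<And>u. u \<in> \<T> \<Longrightarrow> \<bar>u - \<theta> k\<bar> < \<eta> \<Longrightarrow> u \<in> Ts" using star_nbhd[OF \<theta>_star] by blast
  let ?e = "min \<eta> (min (\<theta> (k + 1) - \<theta> k) (\<theta> k - \<theta> (k - 1)))"
  have "u = \<theta> k" if u: "u \<in> \<T>" "\<bar>u - \<theta> k\<bar> < ?e" for u
  proof -
    obtain i where i: "u = \<theta> i" using \<eta>(2)[of u] u star_\<theta> by auto
    have "\<theta> (k - 1) < \<theta> i" "\<theta> i < \<theta> (k + 1)" using u unfolding i by linarith+
    then show ?thesis using i unfolding \<theta>_less by auto
  qed
  moreover have "?e > 0" using \<eta> by auto
  ultimately show ?thesis by blast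
qed

text \<open>The jump stays in \<open>Ts\<close>, so it is some \<open>\<theta> i\<close>; it is at
  most \<open>\<theta> (k + 1)\<close>, and isolation keeps it above
  \<open>\<theta> k\<close>.\<close>

lemma jump_\<theta>: "fwd_jump \<T> (\<theta> k) = \<theta> (k + 1)"
proof -
  have nx: "\<theta> (k + 1) \<in> \<T>" "\<theta> k < \<theta> (k + 1)" using star_subset \<theta>_star by (blast, simp)
  let ?U = "{u \<in> \<T>. \<theta> k < u}"
  have ne: "?U \<noteq> {}" and bdd: "bdd_below ?U" using nx by (blast, auto intro: bdd_belowI[of _ "\<theta> k"])
  have f: "fwd_jump \<T> (\<theta> k) = Inf ?U" using nx by (auto simp: fwd_jump_def)
  obtain i where i: "Inf ?U = \<theta> i" using jump_star[OF \<theta>_star, of k] star_\<theta> f by auto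
  have "\<theta> i \<le> \<theta> (k + 1)" unfolding i[symmetric] using nx bdd by (intro cInf_lower) auto
  moreover obtain e where e: "e > 0" "\<forall>u\<in>\<T>. \<bar>u - \<theta> k\<bar> < e \<longrightarrow> u = \<theta> k" using isolated by blast
  have "\<theta> k + e \<le> Inf ?U" by (intro cInf_greatest ne) (use e in force)
  then have "\<theta> k < \<theta> i" using i e by linarith
  ultimately have "i = k + 1" by auto
  then show ?thesis using f i by auto
qed

section \<open>Delta calculus on the discrete scale\<close>

abbreviation \<mu> where "\<mu> k \<equiv> \<theta> (k + 1) - \<theta> k"

text \<open>Near the isolated point only \<open>u = \<theta> k\<close> has to be tested, and an
  error below every positive multiple of the graininess is zero.\<close>

lemma delta_deriv_\<theta>:
  "has_delta_deriv \<T> Ts f d (\<theta> k) \<longleftrightarrow> f (\<theta> (k + 1)) - f (\<theta> k) = \<mu> k *\<^sub>R d"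
proof
  assume h: "has_delta_deriv \<T> Ts f d (\<theta> k)"
  let ?D = "f (\<theta> (k + 1)) - f (\<theta> k) - \<mu> k *\<^sub>R d"
  have "norm ?D \<le> \<epsilon> * \<bar>\<mu> k\<bar>" if "\<epsilon> > 0" for \<epsilon>
    using h that \<theta>_star[of k] star_subset unfolding has_delta_deriv_def jump_\<theta> by fastforce
  then have "norm ?D \<le> e" if "e > 0" for e
    using that \<theta>_less_step[of k] by (metis abs_of_pos diff_gt_0_iff_gt divide_pos_pos less_irrefl nonzero_eq_divide_eq)
  then have "norm ?D \<le> 0" by (meson dense_ge)
  then show "f (\<theta> (k + 1)) - f (\<theta> k) = \<mu> k *\<^sub>R d" by simp
next
  assume h: "f (\<theta> (k + 1)) - f (\<theta> k) = \<mu> k *\<^sub>R d"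
  obtain e where e: "e > 0" "\<forall>u\<in>\<T>. \<bar>u - \<theta> k\<bar> < e \<longrightarrow> u = \<theta> k" using isolated by blast
  have "\<exists>u\<in>\<T>. \<theta> k < u" using \<theta>_less_step[of k] star_subset \<theta>_star[of "k+1"] by blast
  moreover have "\<forall>u\<in>\<T>. \<bar>u - \<theta> k\<bar> < e \<longrightarrow> u \<in> Ts \<and>
        norm (f (\<theta> (k + 1)) - f u - (\<theta> (k + 1) - u) *\<^sub>R d) \<le> \<epsilon> * \<bar>\<theta> (k + 1) - u\<bar>" if "\<epsilon> > 0" for \<epsilon>
    using e(2) h that by auto
  ultimately show "has_delta_deriv \<T> Ts f d (\<theta> k)"
    unfolding has_delta_deriv_def jump_\<theta> using e(1) by auto
qed

lemma delta_deriv_eq_\<theta>: "delta_deriv \<T> Ts f (\<theta> k) = (f (\<theta> (k + 1)) - f (\<theta> k)) /\<^sub>R \<mu> k"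
proof -
  have "\<mu> k \<noteq> 0" by simp
  then show ?thesis unfolding delta_deriv_def delta_deriv_\<theta>
    by (intro the_equality) (metis scaleR_scaleR right_inverse left_inverse scaleR_one)+
qed

lemma continuous_on_star: "continuous_on Ts (f :: real \<Rightarrow> 'b::metric_space)"
  unfolding continuous_on_iff
proof (intro ballI allI impI)
  fix t e :: real assume t: "t \<in> Ts" "0 < e"
  then obtain d where d: "d > 0" "\<forall>u\<in>\<T>. \<bar>u - t\<bar> < d \<longrightarrow> u = t" using isolated star_\<theta> by metis
  then have "\<forall>x'\<in>Ts. dist x' t < d \<longrightarrow> dist (f x') (f t) < e" using star_subset t by (auto simp: dist_real_def)
  then show "\<exists>d>0. \<forall>x'\<in>Ts. dist x' t < d \<longrightarrow> dist (f x') (f t) < e" using d by blast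
qed

text \<open>For \<open>0 \<le> i\<close> the interval lies in \<open>M\<close>, all of which is
  enumerated; further left \<open>\<T>\<close> may have points outside \<open>Ts\<close>.\<close>

lemma interval_\<theta>: "{\<theta> i..\<theta> j} \<inter> \<T> = \<theta> ` {i..j}" if "0 \<le> i"
proof
  show "{\<theta> i..\<theta> j} \<inter> \<T> \<subseteq> \<theta> ` {i..j}"
  proof
    fix t assume t: "t \<in> {\<theta> i..\<theta> j} \<inter> \<T>"
    then have "t \<in> M" using \<theta>_M[OF that] by auto
    then obtain k where "t = \<theta> k" using M_\<theta> by auto
    then show "t \<in> \<theta> ` {i..j}" using t by auto
  qed
  show "\<theta> ` {i..j} \<subseteq> {\<theta> i..\<theta> j} \<inter> \<T>" using \<theta>_star star_subset by force
qed

end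


section \<open>Delay dynamic systems\<close>

text \<open>Stated for arbitrary sets, because the continuity of \<open>\<delta>p T\<close> must be
  known before discreteness is derived from it.\<close>

lemma has_delta_deriv_imp_continuous:
  assumes f: "has_delta_deriv \<T> S f d t" and S: "S \<subseteq> \<T>"
  shows "continuous (at t within S) f"
  unfolding continuous_within_eps_delta
proof (intro allI impI)
  fix e :: real assume e: "0 < e"
  let ?\<sigma> = "fwd_jump \<T> t"
  define w where "w u = f ?\<sigma> - f u - (?\<sigma> - u) *\<^sub>R d" for u
  \<comment> \<open>For \<open>u\<close> within distance \<open>1\<close> of \<open>t\<close>, the
    errors \<open>w t\<close> and \<open>w u\<close> together are at most
    \<open>\<epsilon> * b\<close>, which is half of \<open>e\<close>.\<close>
  define b where "b = 2 * \<bar>?\<sigma> - t\<bar> + 1"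
  define \<epsilon> where "\<epsilon> = e / (2 * b)"
  have \<epsilon>: "\<epsilon> > 0" "\<epsilon> * b = e / 2" 
  proof -
    have "b > 0" unfolding b_def by (intro add_nonneg_pos) auto
    then show "\<epsilon> > 0" "\<epsilon> * b = e / 2" using e unfolding \<epsilon>_def by simp_all
  qed
  obtain \<eta> where \<eta>: "\<eta> > 0" "\<And>u. u \<in> \<T> \<Longrightarrow> \<bar>u - t\<bar> < \<eta> \<Longrightarrow> norm (w u) \<le> \<epsilon> * \<bar>?\<sigma> - u\<bar>"
    using f \<epsilon>(1) unfolding has_delta_deriv_def w_def by blast
  let ?\<eta> = "min \<eta> (min 1 (e / (2 * (norm d + 1))))"
  have "dist (f u) (f t) < e" if u: "u \<in> S" "dist u t < ?\<eta>" for u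
  proof -
    have t: "t \<in> S" using f by (simp add: has_delta_deriv_def)
    have ut: "\<bar>u - t\<bar> < \<eta>" "\<bar>u - t\<bar> < 1" "\<bar>u - t\<bar> < e / (2 * (norm d + 1))" using u by (auto simp: dist_real_def)
    have "f u - f t = w t - w u - (t - u) *\<^sub>R d" by (simp add: w_def algebra_simps)
    then have "norm (f u - f t) \<le> norm (w t) + norm (w u) + \<bar>t - u\<bar> * norm d"
      by (metis norm_scaleR norm_triangle_ineq4 norm_triangle_le_diff add_mono order_refl)
    also have "norm (w t) \<le> \<epsilon> * \<bar>?\<sigma> - t\<bar>" using \<eta> t S by auto
    also have "norm (w u) \<le> \<epsilon> * (\<bar>?\<sigma> - t\<bar> + 1)"
      by (rule order_trans[OF \<eta>(2)]) (use u S ut \<epsilon> in \<open>auto intro!: mult_left_mono\<close>)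
    also have "\<bar>t - u\<bar> * norm d \<le> \<bar>u - t\<bar> * (norm d + 1)" by (simp add: abs_minus_commute mult_left_mono)
    also have "\<dots> < e / 2" using ut(3) by (simp add: field_simps add_pos_nonneg)
    finally have "norm (f u - f t) < \<epsilon> * b + e / 2" by (simp add: b_def algebra_simps)
    then show ?thesis using \<epsilon>(2) by (simp add: dist_norm)
  qed
  moreover have "?\<eta> > 0" using \<eta> e by (auto intro!: divide_pos_pos mult_pos_pos add_nonneg_pos)
  ultimately show "\<exists>\<eta>>0. \<forall>u\<in>S. dist u t < \<eta> \<longrightarrow> dist (f u) (f t) < e" by blast
qed

text \<open>The derivative of the shift is a ratio of graininesses, so delta periodicity becomes
  ordinary periodicity after weighting with \<open>\<mu>\<close>.\<close>

lemma (in periodic_shifts) graininess_shift: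
  fixes v w :: "'a::real_vector"
  assumes "delta_deriv \<T> Ts (\<delta>p T) (\<theta> k) *\<^sub>R v = w"
  shows "\<mu> (k + idx T) *\<^sub>R v = \<mu> k *\<^sub>R w"
proof -
  have "delta_deriv \<T> Ts (\<delta>p T) (\<theta> k) = \<mu> (k + idx T) / \<mu> k"
    by (simp add: delta_deriv_eq_\<theta> shift_p_\<theta>[OF T_M] divide_inverse algebra_simps)
  moreover have "\<mu> k \<noteq> 0" by simp
  ultimately show ?thesis unfolding assms[symmetric] by simp
qed

lemma sum_telescope_int:
  fixes f :: "int \<Rightarrow> 'a::ab_group_add"
  shows "0 \<le> m \<Longrightarrow> (\<Sum>i\<in>{0..<m}. f (i + 1) - f i) = f m - f 0"
proof (induction m rule: int_ge_induct)
  case (step i)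
  have "{0..<i + 1} = insert i {0..<i}" using step by auto
  then show ?case using step by simp
qed simp

lemma matrix_add_rdistrib: "(M + N) ** K = M ** K + N ** K" for M N K :: "real^'n^'n"
  by (vector matrix_matrix_mult_def sum.distrib[symmetric] field_simps)

text \<open>\<open>normed_space\<close> says that the seminorm on \<open>P_T\<close> separates
  points, and \<open>A_bounded\<close> makes the supremum \<open>normA\<close> meaningful. Being a
  solution includes that the neutral term has a delta derivative \<open>q\<close> at every
  point.\<close>

theorem theorem7:
  fixes \<T> Ts :: "real set" and t0 T s :: real and \<delta>p \<delta>m :: "real \<Rightarrow> real \<Rightarrow> real"
    and A \<Phi> :: "real \<Rightarrow> real^'n^'n"
    and Q :: "real \<Rightarrow> real^'n \<Rightarrow> real^'n"
    and G :: "real \<Rightarrow> real^'n \<Rightarrow> real^'n \<Rightarrow> real^'n"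
    and E1 E2 E3 N r \<alpha> \<beta> J :: real
  defines "P_T \<equiv> (periodic_space Ts \<delta>p \<delta>m T :: (real \<Rightarrow> real^'n) set)"
    and "nrm \<equiv> (period_norm \<T> t0 \<delta>p T :: (real \<Rightarrow> real^'n) \<Rightarrow> real)"
    and "normA \<equiv> (SUP t \<in> {t0..} \<inter> \<T>. row_sum_norm (A t))"
  assumes shifts: "shift_operators \<T> Ts t0 \<delta>p \<delta>m"
    and periodic: "periodic_time_scale \<T> Ts t0 \<delta>p \<delta>m"
    and period: "T \<in> Ts" "shift_period \<T> Ts t0 \<delta>p \<delta>m \<le> T" "0 < T"
    and normed_space: "\<And>x. \<lbrakk>x \<in> P_T; nrm x = 0\<rbrakk> \<Longrightarrow> \<forall>t\<in>Ts. x t = 0"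
    and s: "s \<in> \<T>" "t0 \<le> s"
    and A: "rd_continuous_on \<T> Ts A" "regressive_on \<T> Ts A"
    and A_bounded: "bdd_above ((\<lambda>t. row_sum_norm (A t)) ` ({t0..} \<inter> \<T>))"
    and Q: "rd_continuous_on2 \<T> Ts Q"
    and G: "rd_continuous_on3 \<T> Ts G"
    and A_periodic: "delta_periodic \<T> Ts t0 \<delta>p \<delta>m T A"
    and Q_periodic: "\<And>x t. \<lbrakk>x \<in> P_T; t \<in> Ts\<rbrakk> \<Longrightarrow>
          Q (\<delta>p T t) (x (\<delta>m s (\<delta>p T t))) = Q t (x (\<delta>m s t)) \<and>
          Q (\<delta>m T t) (x (\<delta>m s (\<delta>m T t))) = Q t (x (\<delta>m s t))"
    and G_periodic: "\<And>x t. \<lbrakk>x \<in> P_T; t \<in> Ts\<rbrakk> \<Longrightarrow>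
          delta_deriv \<T> Ts (\<delta>p T) t *\<^sub>R G (\<delta>p T t) (x (\<delta>p T t)) (x (\<delta>m s (\<delta>p T t)))
            = G t (x t) (x (\<delta>m s t)) \<and>
          delta_deriv \<T> Ts (\<delta>m T) t *\<^sub>R G (\<delta>m T t) (x (\<delta>m T t)) (x (\<delta>m s (\<delta>m T t)))
            = G t (x t) (x (\<delta>m s t))"
    and nontrivial: "\<exists>t\<in>Ts. \<exists>q. has_delta_deriv \<T> Ts (\<lambda>u. Q u 0) q t \<and> q + G t 0 0 \<noteq> 0"
    and \<Phi>: "transition_matrix \<T> Ts t0 A \<Phi>"
    and noncritical: "noncritical \<T> Ts t0 \<delta>p \<delta>m A"
    and constants_pos: "0 < E1" "0 < E2" "0 < E3" "0 < N"
    and Q_Lipschitz: "\<And>x y t. \<lbrakk>x \<in> P_T; y \<in> P_T; t \<in> Ts\<rbrakk> \<Longrightarrow>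
          infnorm (Q t (x (\<delta>m s t)) - Q t (y (\<delta>m s t))) \<le> E1 * nrm (\<lambda>u. x u - y u)"
    and G_Lipschitz: "\<And>x y z w t. \<lbrakk>x \<in> P_T; y \<in> P_T; z \<in> P_T; w \<in> P_T; t \<in> Ts\<rbrakk> \<Longrightarrow>
          infnorm (G t (x t) (y (\<delta>m s t)) - G t (z t) (w (\<delta>m s t)))
            \<le> E2 * nrm (\<lambda>u. x u - z u) + E3 * nrm (\<lambda>u. y u - w u)"
    and r: "r = (SUP t \<in> {t0..\<delta>p T t0} \<inter> \<T>. SUP u \<in> {t..\<delta>p T t} \<inter> \<T>.
          row_sum_norm (matrix_inv
            (\<Phi> (fwd_jump \<T> u) ** (matrix_inv (\<Phi> (\<delta>p T t0)) - mat 1) ** matrix_inv (\<Phi> t))))"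
    and N: "r * (\<delta>p T t0 - t0) * (normA * E1 + E2 + E3) \<le> N"
    and \<alpha>: "\<alpha> = nrm (\<lambda>t. Q t 0)"
    and \<beta>: "\<beta> = nrm (\<lambda>t. G t 0 0)"
    and J: "0 < J"
      "E1 * J + \<alpha> + r * (\<delta>p T t0 - t0) * (normA * (\<alpha> + E1 * J) + (E2 + E3) * J + \<beta>) \<le> J"
  shows "\<exists>x\<in>P_T. nrm x \<le> J \<and>
    (\<forall>t\<in>Ts. \<exists>q. has_delta_deriv \<T> Ts (\<lambda>u. Q u (x (\<delta>m s u))) q t \<and>
       has_delta_deriv \<T> Ts x (A t *v x t + q + G t (x t) (x (\<delta>m s t))) t)"
proof -
  interpret shift_operators \<T> Ts t0 \<delta>p \<delta>m by (rule shifts)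
  have total: "shift_total \<T> Ts t0 \<delta>p \<delta>m T" and diff: "rd_differentiable_on \<T> Ts (\<delta>p T)"
    using A_periodic by (simp_all add: delta_periodic_def)
  have deriv: "\<exists>d. has_delta_deriv \<T> Ts (\<delta>p T) d t" if "t \<in> Ts" for t
    using diff that by (simp add: rd_differentiable_on_def)
  have dom: "t \<in> Ts \<Longrightarrow> \<delta>p T t \<in> Ts" "t \<in> Ts \<Longrightarrow> \<delta>m T t \<in> Ts" "t \<in> Ts \<Longrightarrow> \<delta>p T (\<delta>m T t) = t" for t
    using total inverse_m[of T t] by (auto simp: shift_total_def shift_dom_def)
  interpret periodic_shifts \<T> Ts t0 \<delta>p \<delta>m T
  proof
    show "T \<in> Ts" "shift_total \<T> Ts t0 \<delta>p \<delta>m T" by (fact period total)+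
    show "t0 < shift_period \<T> Ts t0 \<delta>p \<delta>m" using periodic by (simp add: periodic_time_scale_def)
    then show "t0 < T" using period by simp
    show "continuous_on Ts (\<delta>p T)" unfolding continuous_on_eq_continuous_within
      using deriv has_delta_deriv_imp_continuous star_subset by blast
    show "fwd_jump \<T> t \<in> Ts" "\<exists>\<eta>>0. \<forall>u\<in>\<T>. \<bar>u - t\<bar> < \<eta> \<longrightarrow> u \<in> Ts" if "t \<in> Ts" for t
      using deriv[OF that] unfolding has_delta_deriv_def by (blast, meson zero_less_one)
  next
    fix V assume V: "openin (top_of_set Ts) V" "closedin (top_of_set Ts) V"
      "\<And>t. t \<in> Ts \<Longrightarrow> \<delta>p T t \<in> V \<longleftrightarrow> t \<in> V" "V \<inter> {t0..} = {}"
    \<comment> \<open>The indicator of \<open>V\<close> is continuous because \<open>V\<close> is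
      open and closed in \<open>Ts\<close>, periodic because \<open>V\<close> is invariant, and of
      norm zero because \<open>V\<close> misses the period interval.\<close>
    define x :: "real \<Rightarrow> real^'n" where "x t = (if t \<in> V then 1 else 0)" for t
    have VT: "V \<subseteq> Ts" using V(1) by (rule openin_imp_subset)
    have "continuous_on (V \<union> (Ts - V)) x" unfolding x_def
      using V VT by (intro continuous_on_cases_local) (auto simp: Un_absorb1 intro: closedin_diff)
    moreover have "periodic_with Ts \<delta>p \<delta>m T x"
      using V(3) dom by (auto simp: periodic_with_def x_def) metis+
    ultimately have "x \<in> P_T" using VT by (simp add: P_T_def periodic_space_def Un_absorb1)
    moreover have "nrm x = 0"
    proof -
      have "t0 \<le> \<delta>p T t0" "t0 \<in> \<T>"
        using shift_initial[of T] period periodic initial_point star_subset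
        by (auto simp: periodic_time_scale_def)
      then have "{t0..\<delta>p T t0} \<inter> \<T> \<noteq> {}" by auto
      moreover have "infnorm (x t) = 0" if "t \<in> {t0..\<delta>p T t0} \<inter> \<T>" for t
        using that V(4) by (auto simp: x_def infnorm_0)
      ultimately show ?thesis by (simp add: nrm_def period_norm_def)
    qed
    ultimately have "\<forall>t\<in>Ts. x t = 0" by (rule normed_space)
    moreover have "x t \<noteq> 0" if "t \<in> V" for t using that by (simp add: x_def)
    ultimately show "V = {}" using VT by blast
  qed

  \<comment> \<open>From here on everything is expressed by indices: \<open>m\<close> is the period
    and \<open>j\<close> the delay.\<close>
  define m where "m = idx T"
  define j where "j = idx s"
  have T_\<theta>: "\<theta> m = T" using \<theta>_idx_M[OF T_M] by (simp add: m_def)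
  have s_M: "s \<in> M" using s by simp
  have m_pos: "0 < m" using T_gt \<theta>_less[of 0 m] by (simp add: T_\<theta> \<theta>_0)
  have p_T: "\<delta>p T (\<theta> k) = \<theta> (k + m)" and m_T: "\<delta>m T (\<theta> k) = \<theta> (k - m)"
    and m_s: "\<delta>m s (\<theta> k) = \<theta> (k - j)" for k
    unfolding m_def j_def by (fact shift_p_\<theta>[OF T_M] shift_m_\<theta>[OF T_M] shift_m_\<theta>[OF s_M])+
  have T_t0: "\<delta>p T t0 = \<theta> m" using p_T[of 0] by (simp add: \<theta>_0)
  have cycle: "{t0..\<delta>p T t0} \<inter> \<T> = \<theta> ` {0..m}" using interval_\<theta>[of 0 m] by (simp add: T_t0 \<theta>_0)
  have nrm_eq: "nrm x = cycle_norm m (\<lambda>k. x (\<theta> k))" for x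
    by (simp add: nrm_def period_norm_def cycle_norm_def cycle image_image)
  have P_T_eq: "x \<in> P_T \<longleftrightarrow> int_periodic m (\<lambda>k. x (\<theta> k))" for x
  proof -
    have "x \<in> P_T \<longleftrightarrow> (\<forall>k. x (\<theta> (k + m)) = x (\<theta> k) \<and> x (\<theta> (k - m)) = x (\<theta> k))"
      by (simp add: P_T_def periodic_space_def continuous_on_star periodic_with_def
          ball_star_iff p_T m_T)
    also have "\<dots> \<longleftrightarrow> int_periodic m (\<lambda>k. x (\<theta> k))"
      unfolding int_periodic_def by (metis diff_add_cancel)
    finally show ?thesis .
  qed
  have lift: "(\<lambda>t. X (idx t)) \<in> P_T" if "int_periodic m X" for X :: "int \<Rightarrow> real^'n"
    using that by (simp add: P_T_eq)

  have \<Phi>_diff: "\<Phi> (\<theta> (k + 1)) - \<Phi> (\<theta> k) = \<mu> k *\<^sub>R (A (\<theta> k) ** \<Phi> (\<theta> k))" for k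
    using \<Phi> \<theta>_star[of k] unfolding transition_matrix_def delta_deriv_\<theta>[symmetric] by blast
  note ratio = graininess_shift[folded m_def]
  have A_per: "\<mu> (k + m) *\<^sub>R A (\<theta> (k + m)) = \<mu> k *\<^sub>R A (\<theta> k)" for k
    using A_periodic by (intro ratio) (simp add: delta_periodic_def p_T[symmetric])
  interpret periodic_recurrence "\<lambda>k. \<Phi> (\<theta> k)" "\<lambda>k. mat 1 + \<mu> k *\<^sub>R A (\<theta> k)" m
  proof
    show "\<Phi> (\<theta> (k + 1)) = (mat 1 + \<mu> k *\<^sub>R A (\<theta> k)) ** \<Phi> (\<theta> k)" for k
      using \<Phi>_diff[of k]
      by (simp only: matrix_add_rdistrib scalar_matrix_assoc[symmetric] matrix_mul_lid diff_eq_eq add.commute)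
    show "invertible (mat 1 + \<mu> k *\<^sub>R A (\<theta> k))" for k
      using A(2) \<theta>_star[of k] unfolding regressive_on_def jump_\<theta>[symmetric] by blast
    show "\<Phi> (\<theta> 0) = mat 1" using \<Phi> by (simp add: transition_matrix_def \<theta>_0)
    show "mat 1 + \<mu> (k + m) *\<^sub>R A (\<theta> (k + m)) = mat 1 + \<mu> k *\<^sub>R A (\<theta> k)" for k
      by (simp only: A_per)
  qed (rule m_pos)
  interpret noncritical_recurrence "\<lambda>k. \<Phi> (\<theta> k)" "\<lambda>k. mat 1 + \<mu> k *\<^sub>R A (\<theta> k)" m
  proof
    fix v assume v: "\<Phi> (\<theta> m) *v v = v"
    \<comment> \<open>This is the solution with initial value \<open>v\<close>; a fixed vector of
      the monodromy matrix makes it periodic, so non-criticality forces it to vanish.\<close>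
    let ?z = "\<lambda>t. \<Phi> t *v v"
    have "has_delta_deriv \<T> Ts ?z (A (\<theta> k) *v ?z (\<theta> k)) (\<theta> k)" for k
      unfolding delta_deriv_\<theta>
      by (simp only: matrix_vector_mult_diff_rdistrib[symmetric] \<Phi>_diff matrix_vector_mul_assoc
          scaleR_matrix_vector_assoc)
    then have "\<forall>t\<in>Ts. has_delta_deriv \<T> Ts ?z (A t *v ?z t) t" by (simp only: ball_star_iff simp_thms)
    moreover have "?z (\<theta> (k + m)) = ?z (\<theta> k)" for k
      using v by (simp add: \<Phi>_periodic matrix_vector_mul_assoc[symmetric])
    then have "?z \<in> P_T" by (simp add: P_T_eq int_periodic_def)
    then have "periodic_in_shifts \<T> Ts t0 \<delta>p \<delta>m ?z"
      using period total by (auto simp: periodic_in_shifts_def P_T_def periodic_space_def)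
    ultimately have "?z (\<theta> 0) = 0"
      using noncritical \<theta>_star[of 0] unfolding noncritical_def by blast
    then show "v = 0" by (simp add: \<Phi>_0)
  qed

  have sum_\<mu>: "(\<Sum>i\<in>{0..<m}. \<mu> i) = \<delta>p T t0 - t0"
    using sum_telescope_int[of m \<theta>] m_pos by (simp add: T_t0 \<theta>_0)
  \<comment> \<open>The inner supremum in \<open>r\<close> includes the right end, so it covers
    \<open>{k..k + m}\<close>, one index more than the summation window. Both index sets are finite,
    hence the suprema are upper bounds.\<close>
  have green_r: "row_sum_norm (green k i) \<le> r" if k: "k \<in> {0..m}" and i: "i \<in> {k..<k + m}" for k i
  proof -
    have "r = (SUP k\<in>{0..m}. SUP i\<in>{k..k + m}. row_sum_norm (green k i))"
      unfolding r cycle image_image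
    proof (intro SUP_cong refl)
      fix k assume "k \<in> {0..m}"
      then have *: "{\<theta> k..\<delta>p T (\<theta> k)} \<inter> \<T> = \<theta> ` {k..k + m}"
        unfolding p_T by (intro interval_\<theta>) simp
      show "(SUP u\<in>{\<theta> k..\<delta>p T (\<theta> k)} \<inter> \<T>. row_sum_norm (matrix_inv
            (\<Phi> (fwd_jump \<T> u) ** (matrix_inv (\<Phi> (\<delta>p T t0)) - mat 1) ** matrix_inv (\<Phi> (\<theta> k)))))
          = (SUP i\<in>{k..k + m}. row_sum_norm (green k i))"
        unfolding * image_image by (simp add: jump_\<theta> green_def T_t0)
    qed
    moreover have "row_sum_norm (green k i) \<le> (SUP i\<in>{k..k + m}. row_sum_norm (green k i))"
      using i by (intro cSUP_upper) auto
    moreover have "\<dots> \<le> (SUP k\<in>{0..m}. SUP i\<in>{k..k + m}. row_sum_norm (green k i))"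
      using k by (intro cSUP_upper) auto
    ultimately show ?thesis by simp
  qed
  have "\<exists>X. int_periodic m X \<and> cycle_norm m X \<le> J \<and>
    (\<forall>k. X (k + 1) - X k = \<mu> k *\<^sub>R (A (\<theta> k) *v X k) + (Q (\<theta> (k + 1)) (X (k + 1 - j)) - Q (\<theta> k) (X (k - j)))
       + \<mu> k *\<^sub>R G (\<theta> k) (X k) (X (k - j)))"
  proof (rule neutral_periodic_solution[where ?E1.0 = E1 and ?E2.0 = E2 and ?E3.0 = E3 and r = r and a = normA
        and \<alpha> = \<alpha> and \<beta> = \<beta> and A = "\<lambda>k. A (\<theta> k)" and Q = "\<lambda>k. Q (\<theta> k)" and G = "\<lambda>k. G (\<theta> k)"
        and \<mu> = \<mu> and j = j and J = J])
    fix X :: "int \<Rightarrow> real^'n" and k assume X: "int_periodic m X"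
    show "Q (\<theta> (k + m)) (X (k + m - j)) = Q (\<theta> k) (X (k - j))"
      using Q_periodic[OF lift[OF X] \<theta>_star, of k] by (simp add: p_T m_s)
    show "\<mu> (k + m) *\<^sub>R G (\<theta> (k + m)) (X (k + m)) (X (k + m - j)) = \<mu> k *\<^sub>R G (\<theta> k) (X k) (X (k - j))"
      using G_periodic[OF lift[OF X] \<theta>_star, of k] by (intro ratio) (simp add: p_T m_s)
  next
    fix X Y :: "int \<Rightarrow> real^'n" and k assume X: "int_periodic m X" and Y: "int_periodic m Y"
    show "infnorm (Q (\<theta> k) (X (k - j)) - Q (\<theta> k) (Y (k - j))) \<le> E1 * cycle_norm m (\<lambda>i. X i - Y i)"
      using Q_Lipschitz[OF lift[OF X] lift[OF Y] \<theta>_star, of k] by (simp add: m_s nrm_eq)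
    show "infnorm (G (\<theta> k) (X k) (X (k - j)) - G (\<theta> k) (Y k) (Y (k - j)))
        \<le> (E2 + E3) * cycle_norm m (\<lambda>i. X i - Y i)"
      using G_Lipschitz[OF lift[OF X] lift[OF X] lift[OF Y] lift[OF Y] \<theta>_star, of k]
      by (simp add: m_s nrm_eq algebra_simps)
  next
    fix k assume "k \<in> {0..<m}"
    then have "\<theta> k \<in> {t0..} \<inter> \<T>" using \<theta>_M[of k] by auto
    then show "row_sum_norm (A (\<theta> k)) \<le> normA" unfolding normA_def by (rule cSUP_upper[OF _ A_bounded])
  next
    obtain t q where t: "t \<in> Ts" "has_delta_deriv \<T> Ts (\<lambda>u. Q u 0) q t" "q + G t 0 0 \<noteq> 0"
      using nontrivial by blast
    obtain k where k: "t = \<theta> k" using star_\<theta> t by blast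
    \<comment> \<open>Nontriviality multiplied by the graininess, which is nonzero.\<close>
    have e: "Q (\<theta> (k + 1)) 0 - Q (\<theta> k) 0 + \<mu> k *\<^sub>R G (\<theta> k) 0 0 = \<mu> k *\<^sub>R (q + G t 0 0)"
      using t(2) unfolding k delta_deriv_\<theta> by (simp add: scaleR_right_distrib)
    show "\<exists>k. Q (\<theta> (k + 1)) 0 - Q (\<theta> k) 0 + \<mu> k *\<^sub>R G (\<theta> k) 0 0 \<noteq> 0"
      by (rule exI[of _ k], unfold e) (use t(3) in simp)
  next
    show "infnorm (Q (\<theta> k) 0) \<le> \<alpha>" if "k \<in> {0..m}" for k
      unfolding \<alpha> nrm_eq using infnorm_le_cycle_norm[OF that, of "\<lambda>k. Q (\<theta> k) 0"] .
    show "infnorm (G (\<theta> k) 0 0) \<le> \<beta>" if "k \<in> {0..m}" for k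
      unfolding \<beta> nrm_eq using infnorm_le_cycle_norm[OF that, of "\<lambda>k. G (\<theta> k) 0 0"] .
  next
    show "E1 * J + \<alpha> + r * sum \<mu> {0..<m} * (normA * (\<alpha> + E1 * J) + (E2 + E3) * J + \<beta>) \<le> J"
      using J(2) by (simp add: sum_\<mu>)
  qed (use constants_pos J green_r in auto)
  then obtain X where X: "int_periodic m X" "cycle_norm m X \<le> J"
    "\<And>k. X (k + 1) - X k = \<mu> k *\<^sub>R (A (\<theta> k) *v X k) + (Q (\<theta> (k + 1)) (X (k + 1 - j)) - Q (\<theta> k) (X (k - j)))
       + \<mu> k *\<^sub>R G (\<theta> k) (X k) (X (k - j))" by blast
  define x where "x t = X (idx t)" for t
  have "\<exists>q. has_delta_deriv \<T> Ts (\<lambda>u. Q u (x (\<delta>m s u))) q (\<theta> k) \<and>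
       has_delta_deriv \<T> Ts x (A (\<theta> k) *v x (\<theta> k) + q + G (\<theta> k) (x (\<theta> k)) (x (\<delta>m s (\<theta> k)))) (\<theta> k)" for k
    unfolding delta_deriv_\<theta>
    \<comment> \<open>The derivative of the neutral term is its difference quotient.\<close>
    by (rule exI[of _ "(Q (\<theta> (k + 1)) (X (k + 1 - j)) - Q (\<theta> k) (X (k - j))) /\<^sub>R \<mu> k"])
      (simp add: x_def m_s X(3) scaleR_right_distrib)
  then have "\<forall>t\<in>Ts. \<exists>q. has_delta_deriv \<T> Ts (\<lambda>u. Q u (x (\<delta>m s u))) q t \<and>
       has_delta_deriv \<T> Ts x (A t *v x t + q + G t (x t) (x (\<delta>m s t))) t"
    by (simp only: ball_star_iff simp_thms)
  moreover have "x \<in> P_T" using lift[OF X(1)] by (simp add: x_def[abs_def])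
  moreover have "nrm x \<le> J" using X(2) by (simp add: nrm_eq x_def)
  ultimately show ?thesis by blast
qed

end
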